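(* Fix partitions $\mu,\nu$ and for $k\ge0$ let $\Phi(\mu,\nu,k)$ be the partition with 2-quotient $(\mu,\nu)$ and 2-core $(k,k-1,\dots,1)$. Then $$\lim_{k\to+\infty}\frac{R_{\Phi(\mu,\nu,k)}(2kx)}{(2k)^{|\mu|+|\nu|}}=(x+1)^{|\mu|}(x-1)^{|\nu|}$$ uniformly for $x$ in compact subsets of $\mathbb{C}$, with rate of convergence $O(k^{-1})$.
   Context: Partitions $\lambda=(\lambda_1\ge\dots\ge\lambda_{\ell(\lambda)}>0)$, degree vector $n_i=\lambda_i+\ell(\lambda)-i$, $\Delta(n_\lambda)=\prod_{i<j}(n_j-n_i)$. Hermite: $\mathrm{He}_0=1,\mathrm{He}_1=x,\mathrm{He}_n=x\mathrm{He}_{n-1}-(n-1)\mathrm{He}_{n-2}$; $\mathrm{He}_\lambda=\mathrm{Wr}[\mathrm{He}_{n_1},\dots,\mathrm{He}_{n_{\ell(\lambda)}}]/\Delta(n_\lambda)$. Maya diagram: a set $M\subset\mathbb{Z}$ containing all sufficiently negative integers and finitely many non-negative ones; $\lambda(M)$ has parts the positive values of $\#\{n\notin M:n<m\}$, $m\in M$. $M_\lambda=\{n<0\}\cup\{n_i\}$, $M_\lambda+t=\{m+t:m\in M_\lambda\}$. For partitions $\mu,\nu$ and $k\in\mathbb{Z}$ choose $s,s'\ge0$ with $\ell(\nu)+s'-\ell(\mu)-s=k$ and set $\Phi(\mu,\nu,k)=\lambda(\{2m:m\in M_\mu+s\}\cup\{2m+1:m\in M_\nu+s'\})$; for $k\ge0$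 its 2-quotient is $(\mu,\nu)$ and its 2-core is $\bar\lambda=(k,\dots,1)$. $R_\lambda$ denotes the monic polynomial of degree $|\mu|+|\nu|$ with $\mathrm{He}_\lambda(x)=x^{|\bar\lambda|}R_\lambda(x^2)$. *)

theory Defs
  imports "HOL-Analysis.Uniform_Limit" "HOL-Computational_Algebra.Polynomial"
    "Jordan_Normal_Form.Determinant"
begin

definition is_partition :: "nat list \<Rightarrow> bool" where
  "is_partition lam \<longleftrightarrow> sorted_wrt (\<ge>) lam \<and> (\<forall>p\<in>set lam. 0 < p)"

definition degs :: "nat list \<Rightarrow> nat list" where
  "degs lam = map (\<lambda>i. lam ! i + length lam - 1 - i) [0..<length lam]"

definition Delta :: "nat list \<Rightarrow> complex" where
  "Delta ns = (\<Prod>(i,j)\<in>{(i,j). i < j \<and> j < length ns}.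
                 of_int (int (ns ! j) - int (ns ! i)))"

fun He :: "nat \<Rightarrow> complex poly" where
  "He 0 = 1"
| "He (Suc 0) = [:0, 1:]"
| "He (Suc (Suc n)) = [:0, 1:] * He (Suc n) - smult (of_nat (Suc n)) (He n)"

definition Wr :: "complex poly list \<Rightarrow> complex poly" where
  "Wr fs = det (mat (length fs) (length fs) (\<lambda>(i, j). (pderiv ^^ i) (fs ! j)))"

definition He_part :: "nat list \<Rightarrow> complex poly" where
  "He_part lam = smult (1 / Delta (degs lam)) (Wr (map He (degs lam)))"

definition Maya_of :: "nat list \<Rightarrow> int set" where
  "Maya_of lam = {n. n < 0} \<union> int ` set (degs lam)"

definition part_of_Maya :: "int set \<Rightarrow> nat list" where
  "part_of_Maya M =
     (let f = (\<lambda>m. card {n. n \<notin> M \<and> n < m})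
      in rev (sort (map f (sorted_list_of_set {m \<in> M. 0 < f m}))))"

definition shift_Maya :: "int set \<Rightarrow> int \<Rightarrow> int set" where
  "shift_Maya M t = (\<lambda>m. m + t) ` M"

text \<open>Phi(mu,nu,k), with the canonical choice s = max 0 (-d), s' = max 0 d,
  where d = k + l(mu) - l(nu), so that l(nu) + s' - l(mu) - s = k.\<close>
definition Phi :: "nat list \<Rightarrow> nat list \<Rightarrow> int \<Rightarrow> nat list" where
  "Phi mu nu k =
     (let d = k + int (length mu) - int (length nu);
          s = max 0 (- d); s' = max 0 d
      in part_of_Maya ((\<lambda>m. 2 * m) ` shift_Maya (Maya_of mu) s
                       \<union> (\<lambda>m. 2 * m + 1) ` shift_Maya (Maya_of nu) s'))"

text \<open>R_lambda for lambda = Phi(mu,nu,k), k \<ge> 0: the polynomial with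
  He_lambda(x) = x^{k(k+1)/2} R_lambda(x^2) (|2-core| = k(k+1)/2).\<close>
definition R_Phi :: "nat list \<Rightarrow> nat list \<Rightarrow> nat \<Rightarrow> complex poly" where
  "R_Phi mu nu k = (THE R. He_part (Phi mu nu (int k))
                      = monom 1 (k * (k + 1) div 2) * pcompose R [:0, 0, 1:])"

end

theory Submission
  imports Defs "HOL-Library.Landau_Symbols"
begin

text \<open>
  Expanding every column of the Wronskian in monomials and using that the Wronskian of powers
  \<open>x ^ e\<^sub>1, \<dots>, x ^ e\<^sub>r\<close> is a Vandermonde product times a power of \<open>x\<close>, the normalised
  polynomial becomes a sum over choices \<open>n \<mapsto> e n \<le> n\<close> of one exponent per degree, weighted by
  Hermite coefficients and by the product of \<open>(e n - e m) / (n - m)\<close> over pairs of degrees.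
  The degrees of \<open>\<Phi>(\<mu>, \<nu>, k)\<close> are \<open>2 a\<close> for \<open>a\<close> a degree of \<open>\<mu>\<close>, then \<open>1, 3, \<dots>, 2 s - 1\<close>, and
  \<open>2 (b + s) + 1\<close> for \<open>b\<close> a degree of \<open>\<nu>\<close>, where \<open>s = k + l(\<mu>) - l(\<nu>)\<close>. Exponents must be distinct
  and have the parity of their degree, so the \<open>s\<close> small odd degrees admit no choice: the number
  of terms does not depend on \<open>k\<close>. After rescaling, the contribution of \<open>a\<close> tends to a binomial
  coefficient, that of \<open>b\<close> to a signed one, and the interaction between \<open>a\<close> and \<open>b\<close> to 1, each
  with error \<open>O(1/k)\<close>. The limiting sums are the same expansions of the Wronskians of
  \<open>(x + 1) ^ a\<close> and \<open>(x - 1) ^ b\<close>, which are powers of \<open>x + 1\<close> and \<open>x - 1\<close>.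
\<close>

subsection \<open>Wronskians of sums of powers\<close>

text \<open>As a function of its last point, the determinant is a polynomial of degree at most
  \<open>n\<close> whose coefficient of degree \<open>n\<close> is the smaller determinant and which
  vanishes at the earlier points. Arbitrary monic rows are allowed because derivatives of powers
  produce falling factorials.\<close>

lemma det_monic_poly_eval:
  fixes p :: "nat \<Rightarrow> 'a::idom poly" and x :: "nat \<Rightarrow> 'a"
  assumes "\<And>i. i < n \<Longrightarrow> degree (p i) = i" and "\<And>i. i < n \<Longrightarrow> lead_coeff (p i) = 1"
  shows "det (mat n n (\<lambda>(i, j). poly (p i) (x j))) = (\<Prod>j<n. \<Prod>i<j. x j - x i)"
  using assms
proof (induction n)
  case 0
  then show ?case by simp
next
  case (Suc n)
  define V where "V = det (mat n n (\<lambda>(i, j). poly (p i) (x j)))"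
  have V: "V = (\<Prod>j<n. \<Prod>i<j. x j - x i)"
    unfolding V_def using Suc by simp
  \<comment> \<open>The last point becomes a free variable \<open>t\<close>. It occurs only in the
    last column, so the cofactors along that column do not depend on it.\<close>
  define A where "A t = mat (Suc n) (Suc n) (\<lambda>(i, j). poly (p i) (if j = n then t else x j))" for t
  have A: "A t \<in> carrier_mat (Suc n) (Suc n)" for t by (simp add: A_def)
  define c where "c i = cofactor (A 0) i n" for i
  have c: "cofactor (A t) i n = c i" if "i \<le> n" for i t
  proof -
    have "mat_delete (A t) i n = mat_delete (A 0) i n"
      using that by (auto simp: mat_delete_def A_def)
    then show ?thesis by (simp add: c_def cofactor_def)
  qed
  have cn: "c n = V"
  proof -
    have "mat_delete (A 0) n n = mat n n (\<lambda>(i, j). poly (p i) (x j))"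
      by (rule eq_matI) (auto simp: mat_delete_def A_def)
    then show ?thesis by (simp add: c_def cofactor_def V_def flip: power_add mult_2)
  qed
  define q where "q = (\<Sum>i<Suc n. smult (c i) (p i))"
  have det_A: "det (A t) = poly q t" for t
  proof -
    have "det (A t) = (\<Sum>i<Suc n. A t $$ (i, n) * cofactor (A t) i n)"
      by (rule laplace_expansion_column[OF A]) simp
    also have "\<dots> = (\<Sum>i<Suc n. poly (p i) t * c i)"
    proof (rule sum.cong)
      fix i assume "i \<in> {..<Suc n}"
      then have "i \<le> n" by simp
      then show "A t $$ (i, n) * cofactor (A t) i n = poly (p i) t * c i"
        unfolding c[OF \<open>i \<le> n\<close>] by (simp add: A_def)
    qed simp
    finally show ?thesis by (simp add: q_def poly_sum mult.commute)
  qed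
  have det_0: "det (mat m m (\<lambda>(i, j). poly (p i) (y j))) = 0"
    if "i < j" "j < m" "y i = y j" for i j m and y :: "nat \<Rightarrow> 'a"
    by (rule det_identical_columns[of _ m i j]) (use that in auto)
  \<comment> \<open>Counting roots requires distinct points. If two of the first \<open>n\<close>
    points coincide, both sides vanish because of equal columns.\<close>
  have "poly q (x n) = V * (\<Prod>i<n. x n - x i)"
  proof (cases "inj_on x {..<n}")
    case False
    then obtain i j where ij: "i < j" "j < n" "x i = x j"
      unfolding inj_on_def by (metis lessThan_iff linorder_neqE_nat)
    have "V = 0" unfolding V_def using det_0[OF ij] .
    moreover have "det (A (x n)) = 0"
      unfolding A_def by (rule det_0[of i j]) (use ij in auto)
    ultimately show ?thesis using det_A by simp
  next
    case True
    \<comment> \<open>The leading terms cancel, so \<open>r\<close> has degree below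
      \<open>n\<close> unless it is zero, yet it vanishes at \<open>n\<close> distinct
      points.\<close>
    define r where "r = q - smult V (\<Prod>i<n. [:- x i, 1:])"
    have q0: "poly q (x j) = 0" if "j < n" for j
      unfolding det_A[symmetric] A_def by (rule det_0[of j n]) (use that in auto)
    have deg_prod: "degree (\<Prod>i<n. [:- x i, 1:]) = n"
      by (subst degree_prod_eq_sum_degree) auto
    have lead_prod: "coeff (\<Prod>i<n. [:- x i, 1:]) n = 1"
      using lead_coeff_prod[of "\<lambda>i. [:- x i, 1:]" "{..<n}"] deg_prod by simp
    have deg_q: "degree q \<le> n"
      unfolding q_def using Suc.prems(1)
      by (intro degree_sum_le) (auto intro: order_trans[OF degree_smult_le])
    have "coeff q n = (\<Sum>i<Suc n. c i * coeff (p i) n)" by (simp add: q_def coeff_sum)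
    also have "\<dots> = (\<Sum>i<Suc n. if i = n then c n else 0)"
      using Suc.prems by (intro sum.cong) (auto simp: coeff_eq_0 less_Suc_eq)
    also have "\<dots> = V" using cn by simp
    finally have cq: "coeff q n = V" .
    have deg_r: "degree r \<le> n"
      unfolding r_def using deg_q deg_prod
      by (intro degree_diff_le order_trans[OF degree_smult_le]) auto
    have cr: "coeff r n = 0" by (simp add: r_def cq lead_prod)
    have roots: "x ` {..<n} \<subseteq> {t. poly r t = 0}"
      using q0 by (auto simp: r_def poly_prod)
    have "r = 0"
    proof (rule ccontr)
      assume "r \<noteq> 0"
      then have "degree r \<noteq> n" using cr by auto
      then have "degree r < n" using deg_r by simp
      moreover have "card (x ` {..<n}) \<le> card {t. poly r t = 0}"
        by (rule card_mono[OF poly_roots_finite[OF \<open>r \<noteq> 0\<close>] roots])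
      moreover have "card {t. poly r t = 0} \<le> degree r"
        by (rule card_poly_roots_bound[OF \<open>r \<noteq> 0\<close>])
      ultimately show False using card_image[OF True] by simp
    qed
    then have "q = smult V (\<Prod>i<n. [:- x i, 1:])" by (simp add: r_def)
    then show ?thesis by (simp add: poly_prod)
  qed
  moreover have "mat (Suc n) (Suc n) (\<lambda>(i, j). poly (p i) (x j)) = A (x n)"
    unfolding A_def by (rule eq_matI) auto
  ultimately show ?case using det_A V by simp
qed

text \<open>The falling factorial as a polynomial; its value at \<open>e\<close> is the coefficient
  produced by differentiating an \<open>e\<close>-th power \<open>i\<close> times.\<close>

definition ffact_poly :: "nat \<Rightarrow> complex poly" where
  "ffact_poly i = (\<Prod>m<i. [:- of_nat m, 1:])"

lemma degree_ffact_poly: "degree (ffact_poly i) = i"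
  unfolding ffact_poly_def by (subst degree_prod_eq_sum_degree) auto

lemma lead_coeff_ffact_poly: "lead_coeff (ffact_poly i) = 1"
  unfolding ffact_poly_def by (subst lead_coeff_prod) simp

lemma poly_ffact_poly_eq_0: "e < i \<Longrightarrow> poly (ffact_poly i) (of_nat e) = 0"
  by (auto simp: ffact_poly_def poly_prod)

text \<open>Asking only that \<open>q\<close> have derivative 1 covers \<open>x\<close> and
  \<open>x + c\<close> at once. When \<open>i\<close> exceeds \<open>e\<close> the exponent
  truncates to 0, but the falling factorial is then 0 as well.\<close>

lemma higher_pderiv_power:
  assumes "pderiv q = 1"
  shows "(pderiv ^^ i) (q ^ e) = smult (poly (ffact_poly i) (of_nat e)) (q ^ (e - i))"
proof (induction i)
  case 0
  then show ?case by (simp add: ffact_poly_def)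
next
  case (Suc i)
  show ?case
  proof (cases "e \<le> i")
    case True
    then have "poly (ffact_poly (Suc i)) (of_nat e) = 0" by (intro poly_ffact_poly_eq_0) simp
    then show ?thesis using True Suc by (simp add: pderiv_smult)
  next
    case False
    then have "pderiv (q ^ (e - i)) = smult (of_nat (e - i)) (q ^ (e - Suc i))"
      using assms pderiv_power_Suc[of q "e - Suc i"]
      by (simp add: Suc_diff_Suc del: pderiv_power_Suc)
    then show ?thesis using False Suc
      by (simp add: pderiv_smult ffact_poly_def of_nat_diff algebra_simps)
  qed
qed

lemma sum_permutes_lessThan:
  assumes "p permutes {0..<n::nat}"
  shows "(\<Sum>j<n. p j) = (\<Sum>j<n. j)"
  using sum.permute[of p "{0..<n}" id] assms by (simp add: atLeast0LessThan comp_def)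

lemma permutes_less: "p permutes {0..<n} \<Longrightarrow> j < n \<Longrightarrow> p j < (n::nat)"
  using permutes_in_image[of p "{0..<n}" j] by simp

definition tri_below :: "nat \<Rightarrow> nat" where "tri_below n = (\<Sum>j<n. j)"

text \<open>Each function contributes exactly one factor to every summand, and the permutation only
  chooses its order of differentiation. The columns can therefore be expanded independently.\<close>

lemma Wr_leibniz:
  "Wr (map f [0..<n]) = (\<Sum>p | p permutes {0..<n}. signof p * (\<Prod>j<n. (pderiv ^^ p j) (f j)))"
proof -
  have "Wr (map f [0..<n]) = det (mat n n (\<lambda>(i, j). (pderiv ^^ i) (f j)))"
    unfolding Wr_def by (auto intro!: arg_cong[where f = det])
  also have "\<dots> = (\<Sum>p | p permutes {0..<n}. signof p * (\<Prod>j<n. (pderiv ^^ p j) (f j)))"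
    by (subst det_col[of _ n])
       (auto intro!: sum.cong prod.cong simp: permutes_less)
  finally show ?thesis .
qed

text \<open>The subtraction in the exponent only truncates when two exponents coincide, in which case
  the Vandermonde product vanishes.\<close>

lemma Wr_powers:
  assumes "pderiv q = 1"
  shows "Wr (map (\<lambda>j. q ^ e j) [0..<n])
         = smult (\<Prod>j<n. \<Prod>i<j. of_nat (e j) - of_nat (e i)) (q ^ (sum e {..<n} - tri_below n))"
proof -
  let ?ff = "\<lambda>i j. poly (ffact_poly i) (of_nat (e j)) :: complex"
  have "(\<Prod>j<n. (pderiv ^^ p j) (q ^ e j))
      = smult (\<Prod>j<n. ?ff (p j) j) (q ^ (sum e {..<n} - tri_below n))"
    if p: "p permutes {0..<n}" for p
  proof (cases "\<forall>j<n. p j \<le> e j")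
    case True
    \<comment> \<open>A permutation merely redistributes the orders 0, ..., \<open>n - 1\<close>, so
      all permutations give the same power of \<open>q\<close>, which factors out of the
      sum.\<close>
    have "(\<Prod>j<n. q ^ (e j - p j)) = q ^ (\<Sum>j<n. e j - p j)" by (simp add: power_sum)
    also have "(\<Sum>j<n. e j - p j) = sum e {..<n} - tri_below n"
      using True sum_permutes_lessThan[OF p] by (subst sum_subtractf_nat) (auto simp: tri_below_def)
    finally show ?thesis by (simp add: higher_pderiv_power[OF assms] prod_smult)
  next
    case False
    then obtain j where j: "j < n" "e j < p j" by (auto simp: not_le)
    have "?ff (p j) j = 0" using j by (simp add: poly_ffact_poly_eq_0)
    then have "(\<Prod>j<n. ?ff (p j) j) = 0" using j by (intro prod_zero) auto
    then show ?thesis by (simp only: higher_pderiv_power[OF assms] prod_smult) simp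
  qed
  then have "Wr (map (\<lambda>j. q ^ e j) [0..<n])
      = (\<Sum>p | p permutes {0..<n}. smult (signof p * (\<Prod>j<n. ?ff (p j) j)) (q ^ (sum e {..<n} - tri_below n)))"
    unfolding Wr_leibniz by (intro sum.cong) (auto simp: sign_def)
  also have "\<dots> = smult (\<Sum>p | p permutes {0..<n}. signof p * (\<Prod>j<n. ?ff (p j) j))
                    (q ^ (sum e {..<n} - tri_below n))"
    by (simp add: smult_sum)
  \<comment> \<open>What remains is a determinant of falling factorials at the points
    \<open>e j\<close>, a Vandermonde determinant with monic rows.\<close>
  also have "(\<Sum>p | p permutes {0..<n}. signof p * (\<Prod>j<n. ?ff (p j) j))
      = det (mat n n (\<lambda>(i, j). ?ff i j))"
    by (subst det_col[of _ n]) (auto intro!: sum.cong prod.cong simp: permutes_less)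
  also have "\<dots> = (\<Prod>j<n. \<Prod>i<j. of_nat (e j) - of_nat (e i))"
    by (rule det_monic_poly_eval) (simp_all add: degree_ffact_poly lead_coeff_ffact_poly
      lead_coeff_ffact_poly[unfolded degree_ffact_poly])
  finally show ?thesis .
qed

section \<open>Vandermonde quotients and the expansion of Wronskians\<close>

definition pairs :: "nat set \<Rightarrow> (nat \<times> nat) set" where
  "pairs S = {(a, b). a \<in> S \<and> b \<in> S \<and> a < b}"

text \<open>The Vandermonde product of the exponents over that of the degrees. Each quotient is
  symmetric in its pair, so a set of degrees suffices and no listing order enters.\<close>

definition pair_ratio :: "nat set \<Rightarrow> (nat \<Rightarrow> nat) \<Rightarrow> complex" where
  "pair_ratio S g = (\<Prod>(a, b)\<in>pairs S. (of_nat (g b) - of_nat (g a)) / (of_nat b - of_nat a))"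

lemma finite_pairs: "finite S \<Longrightarrow> finite (pairs S)"
  by (rule finite_subset[of _ "S \<times> S"]) (auto simp: pairs_def)

lemma Delta_alt: "Delta ns = (\<Prod>j<length ns. \<Prod>i<j. of_nat (ns ! j) - of_nat (ns ! i))"
proof -
  have "(\<Prod>j<length ns. \<Prod>i<j. of_nat (ns ! j) - of_nat (ns ! i))
      = (\<Prod>(j, i)\<in>(SIGMA j:{..<length ns}. {..<j}). of_nat (ns ! j) - of_nat (ns ! i) :: complex)"
    by (subst prod.Sigma) auto
  also have "\<dots> = Delta ns"
    unfolding Delta_def
    by (rule prod.reindex_bij_witness[of _ "\<lambda>(i, j). (j, i)" "\<lambda>(j, i). (i, j)"]) auto
  finally show ?thesis ..
qed

lemma sorted_wrt_greater_imp_distinct: "sorted_wrt (>) (ns :: nat list) \<Longrightarrow> distinct ns"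
  by (induction ns) auto

text \<open>Degrees are listed in decreasing order, so every difference in \<open>Delta\<close> has
  the sign opposite to the one in \<open>pair_ratio\<close>; reversing numerator and denominator
  together leaves each quotient unchanged.\<close>

lemma Delta_ratio:
  assumes ns: "sorted_wrt (>) ns"
  shows "(\<Prod>j<length ns. \<Prod>i<j. of_nat (g (ns ! j)) - of_nat (g (ns ! i))) / Delta ns
         = pair_ratio (set ns) g"
proof -
  let ?I = "SIGMA j:{..<length ns}. {..<j}"
  have dist: "distinct ns" using ns by (rule sorted_wrt_greater_imp_distinct)
  have less: "ns ! j < ns ! i" if "i < j" "j < length ns" for i j
    using ns that by (simp add: sorted_wrt_iff_nth_less)
  have bij: "bij_betw (\<lambda>(j, i). (ns ! j, ns ! i)) ?I (pairs (set ns))"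
    unfolding bij_betw_def
  proof
    show "inj_on (\<lambda>(j, i). (ns ! j, ns ! i)) ?I"
      using dist by (auto simp: inj_on_def nth_eq_iff_index_eq)
    show "(\<lambda>(j, i). (ns ! j, ns ! i)) ` ?I = pairs (set ns)"
    proof (intro equalityI subsetI)
      fix z assume "z \<in> pairs (set ns)"
      then obtain j i where z: "z = (ns ! j, ns ! i)" "j < length ns" "i < length ns" "ns ! j < ns ! i"
        by (auto simp: pairs_def in_set_conv_nth)
      then have "i < j" using less[of j i] by (metis linorder_neqE_nat less_irrefl less_asym)
      then show "z \<in> (\<lambda>(j, i). (ns ! j, ns ! i)) ` ?I" using z by force
    qed (auto simp: pairs_def less)
  qed
  have "(\<Prod>j<length ns. \<Prod>i<j. of_nat (g (ns ! j)) - of_nat (g (ns ! i))) / Delta ns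
      = (\<Prod>(j, i)\<in>?I. (of_nat (g (ns ! j)) - of_nat (g (ns ! i))) / (of_nat (ns ! j) - of_nat (ns ! i)))"
    unfolding Delta_alt prod_dividef[symmetric] by (subst prod.Sigma) auto
  also have "\<dots> = (\<Prod>(j, i)\<in>?I. (of_nat (g (ns ! i)) - of_nat (g (ns ! j))) / (of_nat (ns ! i) - of_nat (ns ! j)))"
    by (rule prod.cong, simp, clarify) (metis minus_diff_eq minus_divide_divide)
  also have "\<dots> = pair_ratio (set ns) g"
    unfolding pair_ratio_def prod.reindex_bij_betw[OF bij, symmetric]
    by (rule prod.cong) auto
  finally show ?thesis .
qed

lemma sum_set_nth:
  "distinct ns \<Longrightarrow> sum g (set ns) = (\<Sum>j<length ns. g (ns ! j))"
  by (metis sum.reindex_bij_betw bij_betw_nth)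

lemma Wr_powers_div_Delta:
  assumes "pderiv q = 1" and ns: "sorted_wrt (>) ns"
  shows "smult (1 / Delta ns) (Wr (map (\<lambda>n. q ^ g n) ns))
         = smult (pair_ratio (set ns) g) (q ^ (sum g (set ns) - tri_below (length ns)))"
proof -
  have dist: "distinct ns" using ns by (rule sorted_wrt_greater_imp_distinct)
  have "map (\<lambda>n. q ^ g n) ns = map (\<lambda>j. q ^ g (ns ! j)) [0..<length ns]"
    by (rule nth_equalityI) auto
  then show ?thesis
    using Delta_ratio[OF ns, of g]
    by (simp add: Wr_powers[OF assms(1)] sum_set_nth[OF dist])
qed

lemma pair_ratio_id: "finite S \<Longrightarrow> pair_ratio S (\<lambda>n. n) = 1"
  unfolding pair_ratio_def by (rule prod.neutral) (auto simp: pairs_def)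

text \<open>Two equal exponents make one numerator zero. This is what discards non-injective choices
  throughout.\<close>

lemma pair_ratio_eq_0:
  assumes "finite S" "\<not> inj_on g S"
  shows "pair_ratio S g = 0"
proof -
  obtain a b where "a \<in> S" "b \<in> S" "a < b" "g a = g b"
    using assms(2) unfolding inj_on_def by (metis linorder_neqE_nat)
  then show ?thesis
    unfolding pair_ratio_def using finite_pairs[OF assms(1)]
    by (intro prod_zero bexI[of _ "(a, b)"]) (auto simp: pairs_def)
qed

lemma smult_sum_right: "smult c (sum f A) = (\<Sum>a\<in>A. smult c (f a))"
  by (induction A rule: infinite_finite_induct) (simp_all add: smult_add_right)

text \<open>Multilinearity of the determinant in its columns. Choices are functions on the set of
  degrees rather than on positions, so that they can later be split according to the kind of
  degree.\<close>

lemma Wr_expansion: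
  fixes ns :: "nat list" and h :: "nat \<Rightarrow> complex poly"
  assumes ns: "distinct ns" and E: "\<And>n. n \<in> set ns \<Longrightarrow> finite (E n)"
    and f: "\<And>n. n \<in> set ns \<Longrightarrow> f n = (\<Sum>e\<in>E n. smult (c n e) (h e))"
  shows "Wr (map f ns) = (\<Sum>g\<in>PiE (set ns) E. smult (\<Prod>n\<in>set ns. c n (g n)) (Wr (map (\<lambda>n. h (g n)) ns)))"
proof -
  let ?N = "length ns" and ?S = "set ns"
  let ?P = "{p. p permutes {0..<?N}}"
  have fin: "finite ?P" by (simp add: finite_permutations)
  have bij: "bij_betw (nth ns) {..<?N} ?S" using ns by (simp add: bij_betw_nth)
  \<comment> \<open>\<open>ix\<close> recovers the position of a degree; it turns products over
    positions into products over the set of degrees, to which \<open>prod_sum_PiE\<close>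
    applies.\<close>
  define ix where "ix = inv_into {..<?N} (nth ns)"
  have ix: "ix (ns ! j) = j" if "j < ?N" for j
    unfolding ix_def using bij that by (simp add: bij_betw_def inv_into_f_f)
  have nth: "ns ! ix n = n" if "n \<in> ?S" for n
    using that ix by (auto simp: in_set_conv_nth)
  have to_set: "(\<Prod>j<?N. X j) = (\<Prod>n\<in>?S. X (ix n))" for X :: "nat \<Rightarrow> complex poly"
    unfolding prod.reindex_bij_betw[OF bij, symmetric] by (rule prod.cong) (auto simp: ix)
  have conv: "map f ns = map (\<lambda>j. f (ns ! j)) [0..<?N]" for f :: "nat \<Rightarrow> complex poly"
    by (rule nth_equalityI) auto
  have expand: "(\<Prod>j<?N. (pderiv ^^ p j) (f (ns ! j)))
      = (\<Sum>g\<in>PiE ?S E. smult (\<Prod>n\<in>?S. c n (g n)) (\<Prod>j<?N. (pderiv ^^ p j) (h (g (ns ! j)))))" for p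
  proof -
    have "(\<Prod>j<?N. (pderiv ^^ p j) (f (ns ! j))) = (\<Prod>n\<in>?S. (pderiv ^^ p (ix n)) (f n))"
      unfolding to_set by (rule prod.cong) (auto simp: nth)
    also have "\<dots> = (\<Prod>n\<in>?S. \<Sum>e\<in>E n. smult (c n e) ((pderiv ^^ p (ix n)) (h e)))"
      by (rule prod.cong) (auto simp: f higher_pderiv_sum higher_pderiv_smult)
    also have "\<dots> = (\<Sum>g\<in>PiE ?S E. \<Prod>n\<in>?S. smult (c n (g n)) ((pderiv ^^ p (ix n)) (h (g n))))"
      by (rule prod_sum_PiE) (auto simp: E)
    also have "\<dots> = (\<Sum>g\<in>PiE ?S E. smult (\<Prod>n\<in>?S. c n (g n)) (\<Prod>n\<in>?S. (pderiv ^^ p (ix n)) (h (g n))))"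
      by (simp add: prod_smult)
    also have "\<dots> = (\<Sum>g\<in>PiE ?S E. smult (\<Prod>n\<in>?S. c n (g n)) (\<Prod>j<?N. (pderiv ^^ p j) (h (g (ns ! j)))))"
      unfolding to_set by (intro sum.cong arg_cong[where f = "smult _"] prod.cong) (auto simp: nth)
    finally show ?thesis .
  qed
  have "Wr (map f ns) = (\<Sum>p\<in>?P. \<Sum>g\<in>PiE ?S E. smult (\<Prod>n\<in>?S. c n (g n))
      (signof p * (\<Prod>j<?N. (pderiv ^^ p j) (h (g (ns ! j))))))"
    unfolding conv Wr_leibniz expand by (simp add: sum_distrib_left)
  also have "\<dots> = (\<Sum>g\<in>PiE ?S E. smult (\<Prod>n\<in>?S. c n (g n)) (Wr (map (\<lambda>n. h (g n)) ns)))"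
    unfolding conv Wr_leibniz by (subst sum.swap) (simp add: smult_sum_right)
  finally show ?thesis .
qed

lemma Wr_monom_expansion:
  assumes ns: "sorted_wrt (>) ns"
    and f: "\<And>n. n \<in> set ns \<Longrightarrow> f n = (\<Sum>e\<le>n. smult (c n e) (monom 1 e))"
  shows "smult (1 / Delta ns) (Wr (map f ns))
         = (\<Sum>g\<in>PiE (set ns) (\<lambda>n. {..n}). smult ((\<Prod>n\<in>set ns. c n (g n)) * pair_ratio (set ns) g)
              (monom 1 (sum g (set ns) - tri_below (length ns))))"
proof -
  have dist: "distinct ns" using ns by (rule sorted_wrt_greater_imp_distinct)
  have mono: "monom 1 e = [:0, 1:] ^ e" for e by (simp add: monom_altdef)
  have X: "pderiv [:0, 1::complex:] = 1" by (simp add: pderiv_pCons)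
  have "smult (1 / Delta ns) (Wr (map f ns))
     = (\<Sum>g\<in>PiE (set ns) (\<lambda>n. {..n}). smult (\<Prod>n\<in>set ns. c n (g n))
          (smult (1 / Delta ns) (Wr (map (\<lambda>n. [:0, 1:] ^ g n) ns))))"
    by (subst Wr_expansion[OF dist _ f]) (auto simp: smult_sum_right mono mult.commute)
  then show ?thesis unfolding Wr_powers_div_Delta[OF X ns] by (simp add: mono)
qed

subsection \<open>Coefficients of Hermite polynomials\<close>

text \<open>The Appell property, by strong induction because the differentiated three-term
  recurrence involves two earlier polynomials. It turns that recurrence into
  \<open>He_Suc\<close>.\<close>

lemma pderiv_He_Suc: "pderiv (He (Suc n)) = smult (of_nat (Suc n)) (He n)"
proof (induction n rule: less_induct)
  case (less n)
  show ?case
  proof (cases n)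
    case 0
    then show ?thesis by (simp add: pderiv_pCons)
  next
    case (Suc m)
    show ?thesis
    proof (cases m)
      case 0
      then show ?thesis using Suc by (simp add: pderiv_pCons pderiv_diff pderiv_mult algebra_simps)
    next
      case (Suc l)
      have "pderiv (He (Suc n)) = He (Suc m) + [:0, 1:] * pderiv (He (Suc m)) - smult (of_nat (Suc m)) (pderiv (He m))"
        unfolding \<open>n = Suc m\<close> He.simps by (simp add: pderiv_diff pderiv_mult pderiv_smult pderiv_pCons)
      also have "\<dots> = He (Suc m) + smult (of_nat (Suc m)) ([:0, 1:] * He m - smult (of_nat (Suc l)) (He l))"
        using less.IH[of m] less.IH[of l] \<open>n = Suc m\<close> \<open>m = Suc l\<close>
        by (simp add: smult_diff_right del: He.simps)
      also have "\<dots> = smult (of_nat (Suc n)) (He n)"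
        unfolding \<open>n = Suc m\<close> \<open>m = Suc l\<close> He.simps(3)[symmetric]
        by (simp only: of_nat_Suc smult_add_left smult_1_left add_ac)
      finally show ?thesis .
    qed
  qed
qed

lemma He_Suc: "He (Suc n) = [:0, 1:] * He n - pderiv (He n)"
  by (cases n) (simp_all add: pderiv_He_Suc del: He.simps(3), simp)

text \<open>Differentiating \<open>He_Suc\<close> and inserting the Appell property yields Hermite's
  differential equation.\<close>

lemma He_ode: "[:0, 1:] * pderiv (He n) - pderiv (pderiv (He n)) = smult (of_nat n) (He n)"
proof -
  have "pderiv (He (Suc n)) = He n + [:0, 1:] * pderiv (He n) - pderiv (pderiv (He n))"
    unfolding He_Suc by (simp add: pderiv_diff pderiv_mult pderiv_pCons)
  then show ?thesis unfolding pderiv_He_Suc by (simp add: smult_add_left algebra_simps)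
qed

text \<open>Comparing coefficients in Hermite's equation links coefficients two apart. The
  asymptotics of the weights are derived from these ratios, starting at the leading coefficient
  1.\<close>

lemma coeff_He_rec:
  "(of_nat n - of_nat e) * coeff (He n) e = - (of_nat (e + 2) * of_nat (e + 1) * coeff (He n) (e + 2))"
proof -
  have "coeff ([:0, 1:] * pderiv (He n) - pderiv (pderiv (He n))) e = of_nat n * coeff (He n) e"
    unfolding He_ode by simp
  moreover have "coeff ([:0, 1:] * pderiv (He n)) e = of_nat e * coeff (He n) e"
    by (cases e) (simp_all add: coeff_pderiv)
  moreover have "coeff (pderiv (pderiv (He n))) e = of_nat (e + 2) * of_nat (e + 1) * coeff (He n) (e + 2)"
    by (simp add: coeff_pderiv numeral_2_eq_2)
  ultimately show ?thesis by (simp add: algebra_simps)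
qed

lemma coeff_He_ge: "n \<le> e \<Longrightarrow> coeff (He n) e = (if e = n then 1 else 0)"
proof (induction n arbitrary: e rule: He.induct)
  case (3 n)
  then show ?case by (cases e) auto
qed (auto simp: coeff_pCons split: nat.splits)

lemma coeff_He_parity: "odd (n + e) \<Longrightarrow> coeff (He n) e = 0"
proof (induction n arbitrary: e rule: He.induct)
  case 1
  then show ?case by (cases e) auto
next
  case 2
  then show ?case by (auto simp: coeff_pCons split: nat.splits)
next
  case (3 n)
  then show ?case by (cases e) auto
qed

lemma He_eq_sum_monom: "He n = (\<Sum>e\<le>n. smult (coeff (He n) e) (monom 1 e))"
proof -
  have "degree (He n) \<le> n" by (rule degree_le) (simp add: coeff_He_ge)
  then show ?thesis by (simp add: smult_monom poly_as_sum_of_monoms')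
qed

subsection \<open>Degree vectors and Maya diagrams\<close>

lemma length_degs [simp]: "length (degs lam) = length lam"
  by (simp add: degs_def)

lemma degs_nth: "i < length lam \<Longrightarrow> degs lam ! i = lam ! i + (length lam - 1 - i)"
  by (simp add: degs_def)

lemma sorted_degs:
  assumes "sorted_wrt (\<ge>) lam"
  shows "sorted_wrt (>) (degs lam)"
  unfolding sorted_wrt_iff_nth_less
proof (intro allI impI)
  fix i j assume ij: "i < j" "j < length (degs lam)"
  then have "lam ! j \<le> lam ! i" using assms by (simp add: sorted_wrt_iff_nth_less)
  then show "degs lam ! i > degs lam ! j" using ij by (simp add: degs_nth)
qed

lemma sum_degs:
  assumes "sorted_wrt (\<ge>) lam"
  shows "\<Sum>(set (degs lam)) = sum_list lam + tri_below (length lam)"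
proof -
  have "\<Sum>(set (degs lam)) = (\<Sum>j<length lam. degs lam ! j)"
    using sum_set_nth[OF sorted_wrt_greater_imp_distinct[OF sorted_degs[OF assms]], of "\<lambda>n. n"] by simp
  also have "\<dots> = (\<Sum>j<length lam. lam ! j) + (\<Sum>j<length lam. length lam - 1 - j)"
    by (simp add: degs_nth flip: sum.distrib)
  also have "(\<Sum>j<length lam. length lam - 1 - j) = tri_below (length lam)"
    unfolding tri_below_def
    by (rule sum.reindex_bij_witness[of _ "\<lambda>j. length lam - 1 - j" "\<lambda>j. length lam - 1 - j"]) auto
  finally show ?thesis by (simp add: sum_list_sum_nth atLeast0LessThan)
qed

text \<open>The part belonging to an element of \<open>S\<close> counts the gaps below it, that is,
  the element minus its rank in \<open>S\<close>; forming the degree vector adds the rank back.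
  Since 0 is a gap, every element of \<open>S\<close> has a positive part and none is
  dropped.\<close>

lemma degs_part_of_Maya:
  fixes S :: "nat set"
  assumes "finite S" "0 \<notin> S" and M: "M = {n. n < 0} \<union> int ` S"
  shows "degs (part_of_Maya M) = rev (sorted_list_of_set S)"
proof -
  define f where "f m = card {n. n \<notin> M \<and> n < m}" for m
  define xs where "xs = sorted_list_of_set S"
  have xs: "sorted xs" "distinct xs" "set xs = S"
    using assms by (simp_all add: xs_def)
  have f_int: "f (int s) = card ({..<s} - S)" for s
  proof -
    have "{n. n \<notin> M \<and> n < int s} = int ` ({..<s} - S)"
    proof (intro equalityI subsetI)
      fix n assume "n \<in> {n. n \<notin> M \<and> n < int s}"
      then have n: "n \<ge> 0" "n \<notin> int ` S" "n < int s" by (auto simp: M not_less)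
      then obtain m where "n = int m" using nonneg_int_cases by blast
      then show "n \<in> int ` ({..<s} - S)" using n by auto
    qed (auto simp: M)
    then show ?thesis by (simp add: f_def card_image)
  qed
  have f_neg: "f m = 0" if "m < 0" for m
  proof -
    have "{n. n \<notin> M \<and> n < m} = {}" using that by (auto simp: M)
    then show ?thesis by (simp only: f_def card.empty)
  qed
  have f_pos: "0 < f (int s)" if "s \<in> S" for s
    using that assms(2) unfolding f_int by (subst card_gt_0_iff) (auto intro: gr0I)
  have "{m \<in> M. 0 < f m} = int ` S"
    using f_neg f_pos by (auto simp: M)
  also have "\<dots> = set (map int xs)" using xs by simp
  finally have "sorted_list_of_set {m \<in> M. 0 < f m} = map int xs"
    using xs(1,2) sorted_list_of_set.idem_if_sorted_distinct[of "map int xs"]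
    by (simp add: distinct_map sorted_map)
  moreover have "sorted (map f (map int xs))"
    using xs(1) unfolding map_map sorted_map o_def f_int
    by (rule sorted_wrt_mono_rel[rotated]) (auto intro!: card_mono)
  ultimately have lam: "part_of_Maya M = rev (map (\<lambda>s. f (int s)) xs)"
    unfolding part_of_Maya_def Let_def f_def[symmetric] by (simp add: sorted_sort_id o_def)
  \<comment> \<open>Exactly \<open>i\<close> elements of \<open>S\<close> lie below the one with
    index \<open>i\<close>. The inequality keeps the natural subtraction exact when \<open>i\<close>
    is added back.\<close>
  have f_xs: "f (int (xs ! i)) = xs ! i - i \<and> i \<le> xs ! i" if "i < length xs" for i
  proof -
    have lt: "xs ! j < xs ! i \<longleftrightarrow> j < i" if "j < length xs" for j
      using xs that \<open>i < length xs\<close>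
      by (metis distinct_conv_nth leI linorder_neqE_nat order_less_le sorted_iff_nth_mono_less not_less)
    have "S \<inter> {..<xs ! i} = (nth xs) ` {..<i}"
    proof (intro equalityI subsetI)
      fix y assume "y \<in> S \<inter> {..<xs ! i}"
      then obtain j where "j < length xs" "y = xs ! j" "xs ! j < xs ! i"
        unfolding xs(3)[symmetric] by (auto simp: in_set_conv_nth)
      then show "y \<in> (nth xs) ` {..<i}" using lt by auto
    next
      fix y assume "y \<in> (nth xs) ` {..<i}"
      then obtain j where "j < i" "y = xs ! j" by auto
      then show "y \<in> S \<inter> {..<xs ! i}" using lt[of j] that unfolding xs(3)[symmetric] by auto
    qed
    moreover have "inj_on (nth xs) {..<i}"
      using xs(2) that by (auto simp: inj_on_def nth_eq_iff_index_eq)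
    ultimately have c: "card (S \<inter> {..<xs ! i}) = i" by (simp add: card_image)
    have "card ({..<xs ! i} - S) = xs ! i - card (S \<inter> {..<xs ! i})"
      using card_Diff_subset_Int[of "{..<xs ! i}" S] assms(1) by (simp add: Int_commute)
    moreover have "card (S \<inter> {..<xs ! i}) \<le> card {..<xs ! i}" by (rule card_mono) auto
    ultimately show ?thesis unfolding f_int c by simp
  qed
  show ?thesis
    unfolding lam xs_def[symmetric]
  proof (rule nth_equalityI)
    fix i assume "i < length (degs (rev (map (\<lambda>s. f (int s)) xs)))"
    then have i: "i < length xs" by simp
    define j where "j = length xs - Suc i"
    have j: "j < length xs" using i by (simp add: j_def)
    have "degs (rev (map (\<lambda>s. f (int s)) xs)) ! i = f (int (xs ! j)) + j"
      using i by (simp add: degs_nth rev_nth j_def)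
    also have "\<dots> = rev xs ! i"
      using f_xs[OF j] i by (simp add: rev_nth j_def[symmetric])
    finally show "degs (rev (map (\<lambda>s. f (int s)) xs)) ! i = rev xs ! i" .
  qed simp
qed

text \<open>The non-negative part of the interleaved Maya diagram. Shifting the second diagram by
  \<open>s\<close> moves the negatives from \<open>-s\<close> to -1 onto 0, ...,
  \<open>s - 1\<close>, which creates the block of small odd degrees.\<close>

definition merge_degs :: "nat set \<Rightarrow> nat set \<Rightarrow> nat \<Rightarrow> nat set" where
  "merge_degs A B s = (\<lambda>a. 2 * a) ` A \<union> (\<lambda>z. 2 * z + 1) ` ({..<s} \<union> (\<lambda>b. b + s) ` B)"

lemma finite_merge_degs: "finite A \<Longrightarrow> finite B \<Longrightarrow> finite (merge_degs A B s)"
  by (simp add: merge_degs_def)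

lemma int_mem_image_iff: "int n \<in> int ` X \<longleftrightarrow> n \<in> X"
  by auto

lemma even_mem_merge_degs: "2 * t \<in> merge_degs A B s \<longleftrightarrow> t \<in> A"
  unfolding merge_degs_def by (auto simp: image_iff) presburger+

lemma odd_mem_merge_degs: "2 * t + 1 \<in> merge_degs A B s \<longleftrightarrow> t \<in> {..<s} \<union> (\<lambda>b. b + s) ` B"
  unfolding merge_degs_def by (auto simp: image_iff) presburger+

text \<open>The equation for \<open>k\<close> is the subtraction-free form of \<open>d = s\<close>,
  so only the second diagram is shifted. Parts of \<open>mu\<close> are positive, hence 0 is not a
  degree of \<open>mu\<close> and stays a gap of the merged diagram.\<close>

lemma degs_Phi:
  assumes mu: "is_partition mu" and k: "k + length mu = s + length nu"
  shows "degs (Phi mu nu (int k)) = rev (sorted_list_of_set (merge_degs (set (degs mu)) (set (degs nu)) s))"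
proof -
  let ?A = "set (degs mu)" and ?B = "set (degs nu)"
  have d: "int k + int (length mu) - int (length nu) = int s" using k by linarith
  have Phi: "Phi mu nu (int k) = part_of_Maya ((\<lambda>m. 2 * m) ` Maya_of mu
      \<union> (\<lambda>m. 2 * m + 1) ` shift_Maya (Maya_of nu) (int s))"
    unfolding Phi_def Let_def d by (simp add: shift_Maya_def)
  have "0 \<notin> ?A"
  proof
    assume "0 \<in> ?A"
    then obtain i where "i < length mu" "degs mu ! i = 0" by (auto simp: in_set_conv_nth)
    then have "mu ! i = 0" by (simp add: degs_nth)
    then show False using mu \<open>i < length mu\<close> unfolding is_partition_def by (metis nth_mem less_irrefl)
  qed
  then have "0 \<notin> merge_degs ?A ?B s" by (auto simp: merge_degs_def)
  moreover have "(\<lambda>m. 2 * m) ` Maya_of mu \<union> (\<lambda>m. 2 * m + 1) ` shift_Maya (Maya_of nu) (int s)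
      = {n. n < 0} \<union> int ` merge_degs ?A ?B s" (is "?L = ?R")
  proof (rule Set.set_eqI)
    fix n :: int
    consider m where "n = 2 * m" | m where "n = 2 * m + 1" by (metis evenE oddE)
    then show "n \<in> ?L \<longleftrightarrow> n \<in> ?R"
    proof cases
      case (1 m)
      have L: "n \<in> ?L \<longleftrightarrow> m < 0 \<or> m \<in> int ` ?A"
        unfolding 1 Maya_of_def shift_Maya_def by (auto simp: image_iff) presburger+
      have R: "n \<in> ?R \<longleftrightarrow> m < 0 \<or> m \<in> int ` ?A"
      proof (cases "m < 0")
        case False
        then obtain t where t: "m = int t" by (metis nonneg_int_cases not_less)
        have "n \<in> ?R \<longleftrightarrow> int (2 * t) \<in> int ` merge_degs ?A ?B s" by (simp add: 1 t)
        also have "\<dots> \<longleftrightarrow> t \<in> ?A" 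
          by (simp only: int_mem_image_iff even_mem_merge_degs)
        finally show ?thesis by (auto simp: t)
      qed (simp add: 1)
      show ?thesis using L R by simp
    next
      case (2 m)
      have L: "n \<in> ?L \<longleftrightarrow> m < int s \<or> m - int s \<in> int ` ?B"
      proof -
        have "n \<notin> (\<lambda>m. 2 * m) ` X" for X unfolding 2 by (auto, presburger)
        moreover have "n \<in> (\<lambda>m. 2 * m + 1) ` shift_Maya Y t \<longleftrightarrow> m - t \<in> Y" for Y t
          unfolding 2 shift_Maya_def by (force simp: image_iff)
        ultimately show ?thesis by (auto simp: Maya_of_def)
      qed
      have R: "n \<in> ?R \<longleftrightarrow> m < int s \<or> m - int s \<in> int ` ?B"
      proof (cases "m < 0")
        case False
        then obtain t where t: "m = int t" by (metis nonneg_int_cases not_less)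
        have "n \<in> ?R \<longleftrightarrow> int (2 * t + 1) \<in> int ` merge_degs ?A ?B s" by (simp add: 2 t add.commute)
        also have "\<dots> \<longleftrightarrow> t \<in> {..<s} \<union> (\<lambda>b. b + s) ` ?B"
          by (simp only: int_mem_image_iff odd_mem_merge_degs)
        also have "\<dots> \<longleftrightarrow> int t < int s \<or> int t - int s \<in> int ` ?B"
        proof -
          have "int t - int s = int x \<longleftrightarrow> t = x + s" for x by linarith
          then show ?thesis by (simp add: image_iff)
        qed
        finally show ?thesis by (simp only: t)
      qed (simp add: 2)
      show ?thesis using L R by simp
    qed
  qed
  ultimately show ?thesis
    unfolding Phi by (intro degs_part_of_Maya) (auto simp: finite_merge_degs)
qed

lemma He_part_Phi_expansion:
  assumes mu: "is_partition mu" and k: "k + length mu = s + length nu"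
  defines "S \<equiv> merge_degs (set (degs mu)) (set (degs nu)) s"
  shows "He_part (Phi mu nu (int k))
         = (\<Sum>g\<in>PiE S (\<lambda>n. {..n}). smult ((\<Prod>n\<in>S. coeff (He n) (g n)) * pair_ratio S g)
              (monom 1 (sum g S - tri_below (card S))))"
proof -
  let ?ns = "degs (Phi mu nu (int k))"
  have ns: "?ns = rev (sorted_list_of_set S)" unfolding S_def by (rule degs_Phi[OF mu k])
  have fin: "finite S" by (simp add: S_def finite_merge_degs)
  have sorted: "sorted_wrt (>) ?ns"
    unfolding ns sorted_wrt_rev using strict_sorted_list_of_set[of S] by simp
  have set: "set ?ns = S" and len: "length ?ns = card S"
    unfolding ns using fin by simp_all
  show ?thesis
    unfolding He_part_def
    by (subst Wr_monom_expansion[OF sorted He_eq_sum_monom]) (simp only: set len)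
qed

subsection \<open>Exponent choices on the merged degree set\<close>

text \<open>Because a quotient is symmetric in its pair, mixed pairs may all be oriented from
  \<open>X\<close> to \<open>Y\<close>, whichever entry is smaller.\<close>

lemma pair_ratio_Un:
  assumes "finite X" "finite Y" "X \<inter> Y = {}"
  shows "pair_ratio (X \<union> Y) g = pair_ratio X g * pair_ratio Y g
         * (\<Prod>x\<in>X. \<Prod>y\<in>Y. (of_nat (g y) - of_nat (g x)) / (of_nat y - of_nat x))"
proof -
  let ?r = "\<lambda>(a, b). (of_nat (g b) - of_nat (g a)) / (of_nat b - of_nat a) :: complex"
  define C where "C = {(a, b). a < b \<and> (a \<in> X \<and> b \<in> Y \<or> a \<in> Y \<and> b \<in> X)}"
  have sym: "?r (a, b) = ?r (b, a)" for a b
    by simp (metis minus_diff_eq minus_divide_divide)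
  have fin: "finite (pairs X)" "finite (pairs Y)" "finite C"
    using assms finite_pairs finite_subset[of C "(X \<union> Y) \<times> (X \<union> Y)"] by (auto simp: C_def)
  have split: "pairs (X \<union> Y) = (pairs X \<union> pairs Y) \<union> C"
    by (auto simp: pairs_def C_def)
  have "prod ?r C = prod ?r (X \<times> Y)"
  proof (rule prod.reindex_bij_witness[of _ "\<lambda>(x, y). if x < y then (x, y) else (y, x)"
        "\<lambda>(a, b). if a \<in> X then (a, b) else (b, a)"])
    fix p assume "p \<in> C"
    then show "?r (case p of (a, b) \<Rightarrow> if a \<in> X then (a, b) else (b, a)) = ?r p"
      using sym by (cases p) (auto split del: if_split split: if_splits)
  qed (use assms(3) in \<open>auto simp: C_def split: if_splits\<close>)
  also have "\<dots> = (\<Prod>x\<in>X. \<Prod>y\<in>Y. ?r (x, y))"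
    by (simp add: prod.cartesian_product)
  finally have C: "prod ?r C = \<dots>" .
  have "pair_ratio (X \<union> Y) g = prod ?r (pairs X \<union> pairs Y) * prod ?r C"
    unfolding pair_ratio_def split using assms(3) fin
    by (intro prod.union_disjoint) (auto simp: pairs_def C_def)
  also have "prod ?r (pairs X \<union> pairs Y) = pair_ratio X g * pair_ratio Y g"
    unfolding pair_ratio_def using assms(3) fin
    by (intro prod.union_disjoint) (auto simp: pairs_def)
  finally show ?thesis unfolding C by simp
qed

text \<open>Differences of old and new values both acquire the factor \<open>c\<close>, which
  cancels. This reduces even degrees, odd degrees and the shifted degrees of \<open>nu\<close> to
  the original sets.\<close>

lemma pair_ratio_affine:
  assumes "c > 0" and g: "\<And>x. x \<in> X \<Longrightarrow> g (c * x + d) = c * \<gamma> x + d"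
  shows "pair_ratio ((\<lambda>x. c * x + d) ` X) g = pair_ratio X \<gamma>"
proof -
  let ?h = "\<lambda>x. c * x + d"
  have bij: "bij_betw (map_prod ?h ?h) (pairs X) (pairs (?h ` X))"
    using assms(1) by (auto simp: bij_betw_def inj_on_def pairs_def)
  show ?thesis
    unfolding pair_ratio_def prod.reindex_bij_betw[OF bij, symmetric]
  proof (rule prod.cong)
    fix z assume "z \<in> pairs X"
    then obtain a b where z: "z = (a, b)" "a \<in> X" "b \<in> X" by (auto simp: pairs_def)
    have "(of_nat (c * v + d) - of_nat (c * w + d) :: complex) = of_nat c * (of_nat v - of_nat w)" for v w
      by (simp add: algebra_simps)
    then show "(case map_prod ?h ?h z of (a, b) \<Rightarrow> (of_nat (g b) - of_nat (g a)) / (of_nat b - of_nat a :: complex))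
        = (case z of (a, b) \<Rightarrow> (of_nat (\<gamma> b) - of_nat (\<gamma> a)) / (of_nat b - of_nat a :: complex))"
      using assms(1) g[OF z(2)] g[OF z(3)] by (simp add: z(1) del: of_nat_add of_nat_mult)
  qed simp
qed

lemma pair_ratio_cong: "(\<And>x. x \<in> X \<Longrightarrow> g x = h x) \<Longrightarrow> pair_ratio X g = pair_ratio X h"
  unfolding pair_ratio_def by (rule prod.cong) (auto simp: pairs_def)

section \<open>Surviving exponent choices and their weights\<close>

definition tail_map :: "nat \<Rightarrow> (nat \<Rightarrow> nat) \<Rightarrow> nat \<Rightarrow> nat" where
  "tail_map s \<beta> z = (if z < s then z else \<beta> (z - s) + s)"

text \<open>Restricting to the merged set places the map in the extensional space \<open>PiE\<close>
  over which the Wronskian expansion sums.\<close>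

definition merge_map :: "nat set \<Rightarrow> nat set \<Rightarrow> nat \<Rightarrow> (nat \<Rightarrow> nat) \<Rightarrow> (nat \<Rightarrow> nat) \<Rightarrow> nat \<Rightarrow> nat" where
  "merge_map A B s \<alpha> \<beta> = restrict (\<lambda>n. if even n then 2 * \<alpha> (n div 2) else 2 * tail_map s \<beta> (n div 2) + 1)
     (merge_degs A B s)"

definition weight :: "nat set \<Rightarrow> (nat \<Rightarrow> nat) \<Rightarrow> complex" where
  "weight S g = (\<Prod>n\<in>S. coeff (He n) (g n)) * pair_ratio S g"

text \<open>What the choice of exponent \<open>2 * e\<close> for the degree \<open>2 * a\<close>
  contributes on its own: the Hermite coefficient and the quotients against the fixed degrees 1, 3,
  ..., \<open>2 * s - 1\<close>.\<close>

definition even_factor :: "nat \<Rightarrow> nat \<Rightarrow> nat \<Rightarrow> complex" where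
  "even_factor s a e = coeff (He (2 * a)) (2 * e)
     * (\<Prod>i<s. (of_nat (2 * i + 1) - of_nat (2 * e)) / (of_nat (2 * i + 1) - of_nat (2 * a)))"

text \<open>The analogue for a large odd degree. Both it and the fixed degrees are odd, so the
  common factor 2 has been cancelled from the quotients.\<close>

definition odd_factor :: "nat \<Rightarrow> nat \<Rightarrow> nat \<Rightarrow> complex" where
  "odd_factor s b e = coeff (He (2 * (b + s) + 1)) (2 * (e + s) + 1)
     * (\<Prod>i<s. (of_nat (e + s) - of_nat i) / (of_nat (b + s) - of_nat i))"

definition cross_factor :: "nat \<Rightarrow> nat \<Rightarrow> nat \<Rightarrow> nat \<Rightarrow> nat \<Rightarrow> complex" where
  "cross_factor s a b e e' = (of_nat (2 * (e' + s) + 1) - of_nat (2 * e)) / (of_nat (2 * (b + s) + 1) - of_nat (2 * a))"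

lemma merge_map_even: "a \<in> A \<Longrightarrow> merge_map A B s \<alpha> \<beta> (2 * a) = 2 * \<alpha> a"
  by (simp add: merge_map_def even_mem_merge_degs)

lemma merge_map_odd:
  "z \<in> {..<s} \<union> (\<lambda>b. b + s) ` B \<Longrightarrow> merge_map A B s \<alpha> \<beta> (2 * z + 1) = 2 * tail_map s \<beta> z + 1"
  using odd_mem_merge_degs[of z A B s] by (simp add: merge_map_def)

lemma merge_degs_cases:
  assumes "n \<in> merge_degs A B s"
  obtains a where "a \<in> A" "n = 2 * a" | i where "i < s" "n = 2 * i + 1" | b where "b \<in> B" "n = 2 * (b + s) + 1"
  using assms unfolding merge_degs_def by auto

lemma tail_map_simps [simp]:
  "i < s \<Longrightarrow> tail_map s \<beta> i = i" "tail_map s \<beta> (b + s) = \<beta> b + s"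
  by (simp_all add: tail_map_def)

context
  fixes A B :: "nat set" and s :: nat
  assumes fin: "finite A" "finite B"
begin

lemma merge_parts:
  defines "X \<equiv> (\<lambda>a. 2 * a) ` A" and "Z \<equiv> {..<s} \<union> (\<lambda>b. b + s) ` B"
  defines "Y \<equiv> (\<lambda>z. 2 * z + 1) ` Z"
  shows "finite X" "finite Y" "X \<inter> Y = {}" "merge_degs A B s = X \<union> Y"
    "{..<s} \<inter> (\<lambda>b. b + s) ` B = {}" "finite Z"
  using fin unfolding X_def Y_def Z_def merge_degs_def by (auto, presburger+)

lemma merge_degs_split:
  fixes F :: "nat \<Rightarrow> 'a::comm_monoid_mult"
  shows "prod F (merge_degs A B s) = (\<Prod>a\<in>A. F (2 * a)) * (\<Prod>i<s. F (2 * i + 1)) * (\<Prod>b\<in>B. F (2 * (b + s) + 1))"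
proof -
  have "prod F (merge_degs A B s) = prod F ((\<lambda>a. 2 * a) ` A) * prod F ((\<lambda>z. 2 * z + 1) ` ({..<s} \<union> (\<lambda>b. b + s) ` B))"
    unfolding merge_parts(4) by (rule prod.union_disjoint[OF merge_parts(1-3)])
  also have "prod F ((\<lambda>a. 2 * a) ` A) = (\<Prod>a\<in>A. F (2 * a))"
    by (subst prod.reindex) (auto simp: inj_on_def)
  also have "prod F ((\<lambda>z. 2 * z + 1) ` ({..<s} \<union> (\<lambda>b. b + s) ` B)) = (\<Prod>z\<in>{..<s} \<union> (\<lambda>b. b + s) ` B. F (2 * z + 1))"
    by (subst prod.reindex) (auto simp: inj_on_def)
  also have "\<dots> = (\<Prod>i<s. F (2 * i + 1)) * (\<Prod>z\<in>(\<lambda>b. b + s) ` B. F (2 * z + 1))"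
    using fin merge_parts(5) by (intro prod.union_disjoint) auto
  also have "(\<Prod>z\<in>(\<lambda>b. b + s) ` B. F (2 * z + 1)) = (\<Prod>b\<in>B. F (2 * (b + s) + 1))"
    by (subst prod.reindex) (auto simp: inj_on_def)
  finally show ?thesis by (simp add: mult.assoc)
qed

text \<open>Pairs of degrees fall into six kinds, according to whether each entry comes from
  \<open>A\<close>, from \<open>B\<close> or from the fixed block. Pairs inside the block contribute
  1; the other five kinds give the five factors.\<close>

lemma pair_ratio_merge_map:
  "pair_ratio (merge_degs A B s) (merge_map A B s \<alpha> \<beta>)
   = pair_ratio A \<alpha> * pair_ratio B \<beta>
     * (\<Prod>a\<in>A. \<Prod>i<s. (of_nat (2 * i + 1) - of_nat (2 * \<alpha> a)) / (of_nat (2 * i + 1) - of_nat (2 * a)))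
     * (\<Prod>b\<in>B. \<Prod>i<s. (of_nat (\<beta> b + s) - of_nat i) / (of_nat (b + s) - of_nat i))
     * (\<Prod>a\<in>A. \<Prod>b\<in>B. cross_factor s a b (\<alpha> a) (\<beta> b))"
proof -
  let ?m = "merge_map A B s \<alpha> \<beta>" and ?t = "tail_map s \<beta>"
  let ?Z = "{..<s} \<union> (\<lambda>b. b + s) ` B"
  have X: "pair_ratio ((\<lambda>a. 2 * a) ` A) ?m = pair_ratio A \<alpha>"
    using pair_ratio_affine[of 2 A ?m 0 \<alpha>] by (simp add: merge_map_even)
  have Y: "pair_ratio ((\<lambda>z. 2 * z + 1) ` ?Z) ?m = pair_ratio ?Z ?t"
    by (rule pair_ratio_affine, simp, rule merge_map_odd)
  have Z: "pair_ratio ?Z ?t = pair_ratio B \<beta>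
      * (\<Prod>b\<in>B. \<Prod>i<s. (of_nat (\<beta> b + s) - of_nat i) / (of_nat (b + s) - of_nat i))"
  proof -
    have "pair_ratio {..<s} ?t = 1"
      using pair_ratio_cong[of "{..<s}" ?t "\<lambda>n. n"] pair_ratio_id[of "{..<s}"] by simp
    moreover have "pair_ratio ((\<lambda>b. b + s) ` B) ?t = pair_ratio B \<beta>"
      using pair_ratio_affine[of 1 B ?t s \<beta>] by simp
    moreover have "(\<Prod>i<s. \<Prod>z\<in>(\<lambda>b. b + s) ` B. (of_nat (?t z) - of_nat (?t i)) / (of_nat z - of_nat i))
        = (\<Prod>b\<in>B. \<Prod>i<s. (of_nat (\<beta> b + s) - of_nat i) / (of_nat (b + s) - of_nat i) :: complex)"
      by (subst prod.swap, subst prod.reindex) (auto simp: inj_on_def intro!: prod.cong)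
    ultimately show ?thesis
      using fin merge_parts(5) by (simp add: pair_ratio_Un)
  qed
  have XY: "(\<Prod>x\<in>(\<lambda>a. 2 * a) ` A. \<Prod>y\<in>(\<lambda>z. 2 * z + 1) ` ?Z. (of_nat (?m y) - of_nat (?m x)) / (of_nat y - of_nat x))
      = (\<Prod>a\<in>A. \<Prod>i<s. (of_nat (2 * i + 1) - of_nat (2 * \<alpha> a)) / (of_nat (2 * i + 1) - of_nat (2 * a)))
        * (\<Prod>a\<in>A. \<Prod>b\<in>B. cross_factor s a b (\<alpha> a) (\<beta> b))" (is "?L = ?R")
  proof -
    let ?r = "\<lambda>a z. (of_nat (2 * ?t z + 1) - of_nat (2 * \<alpha> a)) / (of_nat (2 * z + 1) - of_nat (2 * a)) :: complex"
    have "?L = (\<Prod>a\<in>A. \<Prod>y\<in>(\<lambda>z. 2 * z + 1) ` ?Z. (of_nat (?m y) - of_nat (?m (2 * a))) / (of_nat y - of_nat (2 * a)))"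
      by (subst prod.reindex) (auto simp: inj_on_def)
    also have "\<dots> = (\<Prod>a\<in>A. \<Prod>z\<in>?Z. ?r a z)"
    proof (rule prod.cong[OF refl])
      fix a assume "a \<in> A"
      have "(\<Prod>y\<in>(\<lambda>z. 2 * z + 1) ` ?Z. (of_nat (?m y) - of_nat (?m (2 * a))) / (of_nat y - of_nat (2 * a)))
          = (\<Prod>z\<in>?Z. (of_nat (?m (2 * z + 1)) - of_nat (?m (2 * a))) / (of_nat (2 * z + 1) - of_nat (2 * a)) :: complex)"
        by (subst prod.reindex) (auto simp: inj_on_def)
      also have "\<dots> = (\<Prod>z\<in>?Z. ?r a z)"
        by (rule prod.cong[OF refl]) (simp only: merge_map_odd merge_map_even[OF \<open>a \<in> A\<close>])
      finally show "(\<Prod>y\<in>(\<lambda>z. 2 * z + 1) ` ?Z. (of_nat (?m y) - of_nat (?m (2 * a))) / (of_nat y - of_nat (2 * a)))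
          = (\<Prod>z\<in>?Z. ?r a z)" .
    qed
    also have "\<dots> = (\<Prod>a\<in>A. (\<Prod>z<s. ?r a z) * (\<Prod>z\<in>(\<lambda>b. b + s) ` B. ?r a z))"
      using fin merge_parts(5) by (intro prod.cong[OF refl] prod.union_disjoint) auto
    also have "\<dots> = (\<Prod>a\<in>A. (\<Prod>i<s. (of_nat (2 * i + 1) - of_nat (2 * \<alpha> a)) / (of_nat (2 * i + 1) - of_nat (2 * a)))
        * (\<Prod>b\<in>B. cross_factor s a b (\<alpha> a) (\<beta> b)))"
    proof (intro prod.cong[OF refl] arg_cong2[where f = "(*)"])
      fix a
      show "(\<Prod>z\<in>(\<lambda>b. b + s) ` B. ?r a z) = (\<Prod>b\<in>B. cross_factor s a b (\<alpha> a) (\<beta> b))"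
        by (subst prod.reindex) (auto simp: inj_on_def cross_factor_def)
    qed simp
    finally show ?thesis by (simp add: prod.distrib)
  qed
  show ?thesis
    unfolding merge_parts(4) pair_ratio_Un[OF merge_parts(1-3)] X Y Z XY by (simp only: mult_ac)
qed

text \<open>The fixed degrees select leading coefficients, which are 1. The block therefore enters
  only through its quotients, which \<open>even_factor\<close> and \<open>odd_factor\<close>
  absorb.\<close>

lemma weight_merge_map:
  "weight (merge_degs A B s) (merge_map A B s \<alpha> \<beta>)
   = pair_ratio A \<alpha> * pair_ratio B \<beta> * (\<Prod>a\<in>A. even_factor s a (\<alpha> a)) * (\<Prod>b\<in>B. odd_factor s b (\<beta> b))
     * (\<Prod>a\<in>A. \<Prod>b\<in>B. cross_factor s a b (\<alpha> a) (\<beta> b))"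
proof -
  let ?m = "merge_map A B s \<alpha> \<beta>"
  have "(\<Prod>n\<in>merge_degs A B s. coeff (He n) (?m n))
      = (\<Prod>a\<in>A. coeff (He (2 * a)) (?m (2 * a))) * (\<Prod>i<s. coeff (He (2 * i + 1)) (?m (2 * i + 1)))
        * (\<Prod>b\<in>B. coeff (He (2 * (b + s) + 1)) (?m (2 * (b + s) + 1)))"
    by (rule merge_degs_split)
  also have "(\<Prod>a\<in>A. coeff (He (2 * a)) (?m (2 * a))) = (\<Prod>a\<in>A. coeff (He (2 * a)) (2 * \<alpha> a))"
    by (rule prod.cong) (simp_all only: merge_map_even)
  also have "(\<Prod>i<s. coeff (He (2 * i + 1)) (?m (2 * i + 1))) = 1"
  proof (rule prod.neutral, rule ballI)
    fix i assume "i \<in> {..<s}"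
    then have "?m (2 * i + 1) = 2 * i + 1" by (subst merge_map_odd) auto
    then show "coeff (He (2 * i + 1)) (?m (2 * i + 1)) = 1" by (simp only: coeff_He_ge order_refl) simp
  qed
  also have "(\<Prod>b\<in>B. coeff (He (2 * (b + s) + 1)) (?m (2 * (b + s) + 1)))
      = (\<Prod>b\<in>B. coeff (He (2 * (b + s) + 1)) (2 * (\<beta> b + s) + 1))"
    by (rule prod.cong[OF refl], subst merge_map_odd) auto
  finally show ?thesis
    unfolding weight_def pair_ratio_merge_map even_factor_def odd_factor_def
    by (simp add: prod.distrib mult_ac del: of_nat_add of_nat_mult of_nat_Suc)
qed

lemma inj_on_merge_map_params:
  "inj_on (\<lambda>(\<alpha>, \<beta>). merge_map A B s \<alpha> \<beta>) (PiE A (\<lambda>a. {..a}) \<times> PiE B (\<lambda>b. {..b}))"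
proof (rule inj_onI, clarify)
  fix \<alpha> \<beta> \<alpha>' \<beta>'
  assume mem: "\<alpha> \<in> PiE A (\<lambda>a. {..a})" "\<beta> \<in> PiE B (\<lambda>b. {..b})" "\<alpha>' \<in> PiE A (\<lambda>a. {..a})" "\<beta>' \<in> PiE B (\<lambda>b. {..b})"
    and eq: "merge_map A B s \<alpha> \<beta> = merge_map A B s \<alpha>' \<beta>'"
  have "\<alpha> = \<alpha>'"
  proof (rule PiE_ext[OF mem(1,3)])
    fix a assume "a \<in> A"
    then show "\<alpha> a = \<alpha>' a" using fun_cong[OF eq, of "2 * a"] by (simp add: merge_map_even)
  qed
  moreover have "\<beta> = \<beta>'"
  proof (rule PiE_ext[OF mem(2,4)])
    fix b assume "b \<in> B"
    then have "b + s \<in> {..<s} \<union> (\<lambda>b. b + s) ` B" by simp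
    from merge_map_odd[OF this, of A \<alpha> \<beta>] merge_map_odd[OF this, of A \<alpha>' \<beta>']
    show "\<beta> b = \<beta>' b" using eq by simp
  qed
  ultimately show "\<alpha> = \<alpha>' \<and> \<beta> = \<beta>'" by simp
qed

lemma merge_map_mem:
  assumes "\<alpha> \<in> PiE A (\<lambda>a. {..a})" "\<beta> \<in> PiE B (\<lambda>b. {..b})"
  shows "merge_map A B s \<alpha> \<beta> \<in> PiE (merge_degs A B s) (\<lambda>n. {..n})"
proof
  fix n assume "n \<in> merge_degs A B s"
  then show "merge_map A B s \<alpha> \<beta> n \<in> {..n}"
  proof (cases rule: merge_degs_cases)
    case (1 a)
    then show ?thesis using assms(1) by (auto simp: merge_map_even)
  next
    case (2 i)
    then have "merge_map A B s \<alpha> \<beta> n = n" unfolding 2 by (subst merge_map_odd) auto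
    then show ?thesis by simp
  next
    case (3 b)
    then have "merge_map A B s \<alpha> \<beta> n = 2 * (\<beta> b + s) + 1" unfolding 3 by (subst merge_map_odd) auto
    then show ?thesis using assms(2) 3 by auto
  qed
qed (simp add: merge_map_def)

text \<open>The small odd degrees 1, 3, ..., 2 s - 1 are filled from below, so an injective
  parity-preserving choice of exponents has to fix all of them.\<close>

lemma weight_support:
  assumes g: "g \<in> PiE (merge_degs A B s) (\<lambda>n. {..n})" and nz: "weight (merge_degs A B s) g \<noteq> 0"
  obtains \<alpha> \<beta> where "\<alpha> \<in> PiE A (\<lambda>a. {..a})" "\<beta> \<in> PiE B (\<lambda>b. {..b})" "g = merge_map A B s \<alpha> \<beta>"
proof -
  let ?S = "merge_degs A B s"
  have finS: "finite ?S" using fin by (rule finite_merge_degs)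
  have le: "g n \<le> n" if "n \<in> ?S" for n using g that by auto
  have inj: "inj_on g ?S" using nz pair_ratio_eq_0[OF finS, of g] by (auto simp: weight_def)
  have "coeff (He n) (g n) \<noteq> 0" if "n \<in> ?S" for n
    using nz finS that by (auto simp: weight_def)
  then have parity: "even (g n) \<longleftrightarrow> even n" if "n \<in> ?S" for n
    using that coeff_He_parity[of n "g n"] by fastforce
  have small: "2 * i + 1 \<in> ?S" if "i < s" for i
    using that odd_mem_merge_degs[of i A B s] by simp
  have fixed: "g (2 * i + 1) = 2 * i + 1" if "i < s" for i
    using that
  proof (induction i rule: less_induct)
    case (less i)
    have "odd (g (2 * i + 1))" using parity[OF small[OF less.prems]] by simp
    then obtain j where j: "g (2 * i + 1) = 2 * j + 1" by (rule oddE)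
    have "j \<le> i" using le[OF small[OF less.prems]] j by simp
    moreover have "\<not> j < i"
    proof
      assume "j < i"
      then have "g (2 * j + 1) = g (2 * i + 1)" using less j by simp
      then have "2 * j + 1 = 2 * i + 1"
        using inj_onD[OF inj] small less.prems \<open>j < i\<close> by (metis less_trans)
      then show False using \<open>j < i\<close> by simp
    qed
    ultimately show ?case using j by simp
  qed
  define \<alpha> where "\<alpha> = restrict (\<lambda>a. g (2 * a) div 2) A"
  define \<beta> where "\<beta> = restrict (\<lambda>b. g (2 * (b + s) + 1) div 2 - s) B"
  have even: "g (2 * a) = 2 * \<alpha> a \<and> \<alpha> a \<le> a" if "a \<in> A" for a
  proof -
    have "2 * a \<in> ?S" using that by (simp add: even_mem_merge_degs)
    then show ?thesis using parity[of "2 * a"] le[of "2 * a"] that by (auto simp: \<alpha>_def)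
  qed
  have odd: "g (2 * (b + s) + 1) = 2 * (\<beta> b + s) + 1 \<and> \<beta> b \<le> b" if "b \<in> B" for b
  proof -
    have mem: "2 * (b + s) + 1 \<in> ?S" using that odd_mem_merge_degs[of "b + s" A B s] by simp
    have "odd (g (2 * (b + s) + 1))" using parity[OF mem] by simp
    then obtain j where j: "g (2 * (b + s) + 1) = 2 * j + 1" by (rule oddE)
    \<comment> \<open>A value \<open>2 * j + 1\<close> with \<open>j < s\<close> is already taken by
      a fixed degree. Hence the natural subtraction of \<open>s\<close> in \<open>\<beta>\<close> is
      exact.\<close>
    have "\<not> j < s"
    proof
      assume "j < s"
      then have "g (2 * j + 1) = g (2 * (b + s) + 1)" using fixed j by simp
      then have "2 * j + 1 = 2 * (b + s) + 1" using inj_onD[OF inj] small mem \<open>j < s\<close> by metis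
      then show False using \<open>j < s\<close> by simp
    qed
    then have "g (2 * (b + s) + 1) div 2 - s = j - s" "s \<le> j" using j by simp_all
    then show ?thesis using that le[OF mem] j by (simp add: \<beta>_def)
  qed
  show ?thesis
  proof (rule that)
    show \<alpha>: "\<alpha> \<in> PiE A (\<lambda>a. {..a})" using even by (intro PiE_I) (auto simp: \<alpha>_def)
    show \<beta>: "\<beta> \<in> PiE B (\<lambda>b. {..b})" using odd by (intro PiE_I) (auto simp: \<beta>_def)
    show "g = merge_map A B s \<alpha> \<beta>"
    proof (rule PiE_ext[OF g merge_map_mem[OF \<alpha> \<beta>]])
      fix n assume "n \<in> ?S"
      then show "g n = merge_map A B s \<alpha> \<beta> n"
      proof (cases rule: merge_degs_cases)
        case (1 a)
        then show ?thesis using even by (simp add: merge_map_even)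
      next
        case (2 i)
        then show ?thesis unfolding 2 by (subst merge_map_odd) (use fixed in auto)
      next
        case (3 b)
        then show ?thesis unfolding 3 by (subst merge_map_odd) (use odd in auto)
      qed
    qed
  qed
qed

text \<open>All other choices have weight 0 and the parametrisation is injective. From here on the
  index set depends on \<open>A\<close> and \<open>B\<close> only, not on \<open>s\<close>.\<close>

lemma sum_weight_merge:
  fixes H :: "(nat \<Rightarrow> nat) \<Rightarrow> complex poly"
  shows "(\<Sum>g\<in>PiE (merge_degs A B s) (\<lambda>n. {..n}). smult (weight (merge_degs A B s) g) (H g))
    = (\<Sum>(\<alpha>, \<beta>)\<in>PiE A (\<lambda>a. {..a}) \<times> PiE B (\<lambda>b. {..b}).
         smult (weight (merge_degs A B s) (merge_map A B s \<alpha> \<beta>)) (H (merge_map A B s \<alpha> \<beta>)))"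
proof -
  let ?P = "PiE A (\<lambda>a. {..a}) \<times> PiE B (\<lambda>b. {..b})" and ?m = "\<lambda>(\<alpha>, \<beta>). merge_map A B s \<alpha> \<beta>"
  let ?F = "\<lambda>g. smult (weight (merge_degs A B s) g) (H g)"
  have "sum ?F (PiE (merge_degs A B s) (\<lambda>n. {..n})) = sum ?F (?m ` ?P)"
  proof (rule sum.mono_neutral_right)
    show "finite (PiE (merge_degs A B s) (\<lambda>n. {..n}))"
      using fin by (intro finite_PiE finite_merge_degs) auto
    show "?m ` ?P \<subseteq> PiE (merge_degs A B s) (\<lambda>n. {..n})" using merge_map_mem by auto
    show "\<forall>g\<in>PiE (merge_degs A B s) (\<lambda>n. {..n}) - ?m ` ?P. ?F g = 0"
    proof
      fix g assume g: "g \<in> PiE (merge_degs A B s) (\<lambda>n. {..n}) - ?m ` ?P"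
      have "weight (merge_degs A B s) g = 0"
      proof (rule ccontr)
        assume "weight (merge_degs A B s) g \<noteq> 0"
        with g obtain \<alpha> \<beta> where "(\<alpha>, \<beta>) \<in> ?P" "g = ?m (\<alpha>, \<beta>)"
          using weight_support[of g] by (metis DiffD1 SigmaI case_prod_conv)
        then show False using g by blast
      qed
      then show "?F g = 0" by simp
    qed
  qed
  also have "\<dots> = (\<Sum>p\<in>?P. ?F (?m p))"
    by (subst sum.reindex[OF inj_on_merge_map_params]) simp
  finally show ?thesis by (simp add: case_prod_unfold)
qed

end

section \<open>Exponents of \<open>x\<close> and the expansion of \<open>R_Phi\<close>\<close>

lemma double_tri_below: "2 * int (tri_below n) = int n * (int n - 1)"
  unfolding tri_below_def by (induction n) (auto simp: algebra_simps)

lemma tri_below_Suc: "tri_below (Suc k) = k * (k + 1) div 2"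
proof -
  have "2 * tri_below (Suc k) = k * (k + 1)"
    using double_tri_below[of "Suc k"] by (simp add: algebra_simps flip: of_nat_mult of_nat_add)
  then show ?thesis by simp
qed

text \<open>The maximum of a finite set is at least the number of the remaining elements. For
  injective choices this makes the truncated subtractions in the exponents exact.\<close>

lemma tri_below_card_le_sum:
  fixes T :: "nat set"
  assumes "finite T"
  shows "tri_below (card T) \<le> \<Sum>T"
  using assms
proof (induction T rule: finite_linorder_max_induct)
  case (insert b T)
  have "card T \<le> card {..<b}" by (rule card_mono) (use insert in auto)
  moreover have "b \<notin> T" using insert by blast
  ultimately show ?case using insert by (simp add: tri_below_def)
qed (simp add: tri_below_def)

lemma tri_below_le_sum_inj: "finite A \<Longrightarrow> inj_on \<alpha> A \<Longrightarrow> tri_below (card A) \<le> sum \<alpha> A"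
  using tri_below_card_le_sum[of "\<alpha> ` A"] by (simp add: card_image sum.reindex)

text \<open>The terms quadratic in \<open>s\<close> combine with the Vandermonde degree to
  \<open>k * (k + 1) div 2\<close>, the size of the 2-core. What is left is even, since all freedom
  lies in the halved exponents.\<close>

lemma merge_exponent:
  assumes fin: "finite A" "finite B" and inj: "inj_on \<alpha> A" "inj_on \<beta> B" and k: "k + card A = s + card B"
  shows "sum (merge_map A B s \<alpha> \<beta>) (merge_degs A B s) - tri_below (card (merge_degs A B s))
         = k * (k + 1) div 2 + 2 * ((sum \<alpha> A - tri_below (card A)) + (sum \<beta> B - tri_below (card B)))"
proof -
  let ?m = "merge_map A B s \<alpha> \<beta>" and ?S = "merge_degs A B s"
  let ?p = "card A" and ?q = "card B"
  note parts = merge_parts[OF fin]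
  have split: "sum F ?S = (\<Sum>a\<in>A. F (2 * a)) + (\<Sum>i<s. F (2 * i + 1)) + (\<Sum>b\<in>B. F (2 * (b + s) + 1))"
    for F :: "nat \<Rightarrow> nat"
  proof -
    have "sum F ?S = sum F ((\<lambda>a. 2 * a) ` A) + sum F ((\<lambda>z. 2 * z + 1) ` ({..<s} \<union> (\<lambda>b. b + s) ` B))"
      unfolding parts(4) by (rule sum.union_disjoint[OF parts(1-3)])
    also have "sum F ((\<lambda>a. 2 * a) ` A) = (\<Sum>a\<in>A. F (2 * a))"
      by (subst sum.reindex) (auto simp: inj_on_def)
    also have "sum F ((\<lambda>z. 2 * z + 1) ` ({..<s} \<union> (\<lambda>b. b + s) ` B)) = (\<Sum>z\<in>{..<s} \<union> (\<lambda>b. b + s) ` B. F (2 * z + 1))"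
      by (subst sum.reindex) (auto simp: inj_on_def)
    also have "\<dots> = (\<Sum>i<s. F (2 * i + 1)) + (\<Sum>z\<in>(\<lambda>b. b + s) ` B. F (2 * z + 1))"
      using fin parts(5) by (intro sum.union_disjoint) auto
    also have "(\<Sum>z\<in>(\<lambda>b. b + s) ` B. F (2 * z + 1)) = (\<Sum>b\<in>B. F (2 * (b + s) + 1))"
      by (subst sum.reindex) (auto simp: inj_on_def)
    finally show ?thesis by simp
  qed
  have card: "card ?S = ?p + s + ?q"
    using split[of "\<lambda>_. 1"] by simp
  have "sum ?m ?S = (\<Sum>a\<in>A. 2 * \<alpha> a) + (\<Sum>i<s. 2 * i + 1) + (\<Sum>b\<in>B. 2 * (\<beta> b + s) + 1)"
    unfolding split
  proof (intro arg_cong2[where f = "(+)"] sum.cong[OF refl])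
    show "?m (2 * i + 1) = 2 * i + 1" if "i \<in> {..<s}" for i
      using that by (subst merge_map_odd) auto
    show "?m (2 * (b + s) + 1) = 2 * (\<beta> b + s) + 1" if "b \<in> B" for b
      using that by (subst merge_map_odd) auto
  qed (simp add: merge_map_even)
  also have "\<dots> = 2 * sum \<alpha> A + (2 * tri_below s + s) + (2 * sum \<beta> B + ?q * (2 * s + 1))"
    unfolding sum.distrib sum_distrib_left[symmetric] by (simp add: tri_below_def algebra_simps)
  finally have m: "sum ?m ?S = \<dots>" .
  obtain u v where uv: "sum \<alpha> A = tri_below ?p + u" "sum \<beta> B = tri_below ?q + v"
    using tri_below_le_sum_inj[OF fin(1) inj(1)] tri_below_le_sum_inj[OF fin(2) inj(2)] by (metis le_Suc_ex)
  \<comment> \<open>Doubling and passing to integers removes the divisions and truncated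
    subtractions, so that after inserting \<open>k = s + q - p\<close> a polynomial identity
    remains.\<close>
  have "2 * int (2 * tri_below ?p + 2 * tri_below s + s + 2 * tri_below ?q + ?q * (2 * s + 1))
      = 2 * int (tri_below (Suc k) + tri_below (?p + s + ?q))"
  proof -
    have kk: "int k = int s + int ?q - int ?p" using k by linarith
    have "2 * int (2 * tri_below ?p + 2 * tri_below s + s + 2 * tri_below ?q + ?q * (2 * s + 1))
       = 2 * (2 * int (tri_below ?p)) + 2 * (2 * int (tri_below s)) + 2 * int s + 2 * (2 * int (tri_below ?q)) + 2 * int ?q * (2 * int s + 1)"
      by (simp add: algebra_simps)
    also have "\<dots> = 2 * int (tri_below (Suc k)) + 2 * int (tri_below (?p + s + ?q))"
      unfolding double_tri_below of_nat_Suc of_nat_add kk by (simp add: algebra_simps)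
    finally show ?thesis by simp
  qed
  then have "2 * tri_below ?p + 2 * tri_below s + s + 2 * tri_below ?q + ?q * (2 * s + 1)
      = tri_below (Suc k) + tri_below (?p + s + ?q)" by (simp only: mult_cancel_left of_nat_eq_iff) simp
  then show ?thesis unfolding m card uv tri_below_Suc[symmetric] by simp
qed

text \<open>Every surviving monomial is the core power times an even power of \<open>x\<close>, so
  the sum has the shape that characterises \<open>R_Phi\<close>, with the even exponents
  halved.\<close>

lemma R_Phi_expansion:
  assumes mu: "is_partition mu" and nu: "is_partition nu" and k: "k + length mu = s + length nu"
  defines "A \<equiv> set (degs mu)" and "B \<equiv> set (degs nu)"
  shows "R_Phi mu nu k = (\<Sum>(\<alpha>, \<beta>)\<in>PiE A (\<lambda>a. {..a}) \<times> PiE B (\<lambda>b. {..b}).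
           smult (weight (merge_degs A B s) (merge_map A B s \<alpha> \<beta>))
             (monom 1 ((sum \<alpha> A - tri_below (length mu)) + (sum \<beta> B - tri_below (length nu)))))"
    (is "_ = ?R")
proof -
  let ?P = "PiE A (\<lambda>a. {..a}) \<times> PiE B (\<lambda>b. {..b})"
  let ?w = "\<lambda>\<alpha> \<beta>. weight (merge_degs A B s) (merge_map A B s \<alpha> \<beta>)"
  let ?u = "\<lambda>\<alpha> \<beta>. (sum \<alpha> A - tri_below (length mu)) + (sum \<beta> B - tri_below (length nu))"
  have fin: "finite A" "finite B" by (simp_all add: A_def B_def)
  have card: "card A = length mu" "card B = length nu"
    using mu nu sorted_degs sorted_wrt_greater_imp_distinct
    by (auto simp: A_def B_def is_partition_def distinct_card)
  have pow: "pcompose (monom 1 n) r = r ^ n" for n and r :: "complex poly"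
    by (induction n) (simp_all add: monom_Suc pcompose_pCons pcompose_1)
  have X2: "[:0, 0, 1::complex:] = [:0, 1:] ^ 2" by (simp add: power2_eq_square)
  have pc: "pcompose (monom 1 n) [:0, 0, 1::complex:] = monom 1 (2 * n)" for n
    unfolding pow X2 by (simp add: monom_altdef power_mult)
  have "He_part (Phi mu nu (int k)) = (\<Sum>(\<alpha>, \<beta>)\<in>?P. smult (?w \<alpha> \<beta>)
      (monom 1 (sum (merge_map A B s \<alpha> \<beta>) (merge_degs A B s) - tri_below (card (merge_degs A B s)))))"
    unfolding He_part_Phi_expansion[OF mu k] A_def[symmetric] B_def[symmetric] weight_def[symmetric]
    by (rule sum_weight_merge[OF fin])
  also have "\<dots> = (\<Sum>(\<alpha>, \<beta>)\<in>?P. smult (?w \<alpha> \<beta>) (monom 1 (k * (k + 1) div 2 + 2 * ?u \<alpha> \<beta>)))"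
  proof (intro sum.cong[OF refl], clarify)
    fix \<alpha> \<beta>
    show "smult (?w \<alpha> \<beta>) (monom 1 (sum (merge_map A B s \<alpha> \<beta>) (merge_degs A B s) - tri_below (card (merge_degs A B s))))
        = smult (?w \<alpha> \<beta>) (monom 1 (k * (k + 1) div 2 + 2 * ?u \<alpha> \<beta>))"
    proof (cases "inj_on \<alpha> A \<and> inj_on \<beta> B")
      case True
      then show ?thesis using merge_exponent[OF fin, of \<alpha> \<beta> k s] k by (simp add: card)
    next
      \<comment> \<open>Without injectivity the exponent formula may fail through truncation, but
        the weight is 0.\<close>
      case False
      then have "?w \<alpha> \<beta> = 0"
        unfolding weight_merge_map[OF fin] using pair_ratio_eq_0 fin by fastforce
      then show ?thesis by simp
    qed
  qed
  also have "\<dots> = monom 1 (k * (k + 1) div 2) * pcompose ?R [:0, 0, 1:]"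
    by (simp add: pcompose_sum pcompose_smult pc sum_distrib_left mult_monom case_prod_unfold)
  finally have eq: "He_part (Phi mu nu (int k)) = \<dots>" .
  show ?thesis
    unfolding R_Phi_def
  proof (rule the_equality[where a = ?R], rule eq)
    \<comment> \<open>Substituting \<open>x ^ 2\<close> is injective on polynomials, so the
      description by \<open>THE\<close> determines this sum uniquely.\<close>
    fix R assume "He_part (Phi mu nu (int k)) = monom 1 (k * (k + 1) div 2) * pcompose R [:0, 0, 1:]"
    then have "pcompose (R - ?R) [:0, 0, 1:] = 0"
      unfolding eq by (simp add: pcompose_diff)
    then have "R - ?R = 0" by (rule pcompose_eq_0) simp
    then show "R = ?R" by simp
  qed
qed

text \<open>The normalised Wronskian of the powers of \<open>x + c\<close> is computed twice:
  directly, where the Vandermonde quotient is 1, and after expanding every column by the binomial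
  theorem.\<close>

lemma sum_pair_ratio_binomial:
  fixes x c :: complex
  assumes lam: "sorted_wrt (\<ge>) lam"
  defines "A \<equiv> set (degs lam)"
  shows "(\<Sum>\<alpha>\<in>PiE A (\<lambda>a. {..a}). pair_ratio A \<alpha> * (\<Prod>a\<in>A. of_nat (a choose \<alpha> a) * c ^ (a - \<alpha> a))
           * x ^ (sum \<alpha> A - tri_below (length lam))) = (x + c) ^ sum_list lam"
proof -
  have binom: "[:c, 1:] ^ n = (\<Sum>e\<le>n. smult (of_nat (n choose e) * c ^ (n - e)) (monom 1 e))" for n
  proof -
    have "[:c, 1:] ^ n = ([:0, 1:] + [:c:]) ^ n" by simp
    also have "\<dots> = (\<Sum>e\<le>n. of_nat (n choose e) * [:0, 1:] ^ e * [:c:] ^ (n - e))"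
      by (rule binomial_ring)
    also have "\<dots> = (\<Sum>e\<le>n. smult (of_nat (n choose e) * c ^ (n - e)) (monom 1 e))"
      by (rule sum.cong) (auto simp: monom_altdef of_nat_poly poly_const_pow mult.commute)
    finally show ?thesis .
  qed
  have sorted: "sorted_wrt (>) (degs lam)" by (rule sorted_degs[OF lam])
  have "pderiv [:c, 1:] = 1" by (simp add: pderiv_pCons)
  from Wr_powers_div_Delta[OF this sorted, of "\<lambda>n. n"]
  have "[:c, 1:] ^ sum_list lam = smult (1 / Delta (degs lam)) (Wr (map (\<lambda>n. [:c, 1:] ^ n) (degs lam)))"
    using sum_degs[OF lam] by (simp add: pair_ratio_id)
  also have "\<dots> = (\<Sum>\<alpha>\<in>PiE A (\<lambda>a. {..a}). smult ((\<Prod>a\<in>A. of_nat (a choose \<alpha> a) * c ^ (a - \<alpha> a)) * pair_ratio A \<alpha>)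
           (monom 1 (sum \<alpha> A - tri_below (length lam))))"
    unfolding A_def by (subst Wr_monom_expansion[OF sorted binom]) simp
  finally have "poly ([:c, 1:] ^ sum_list lam) x = poly \<dots> x" by simp
  then show ?thesis by (simp add: poly_sum poly_monom add.commute mult_ac)
qed

subsection \<open>Asymptotics of the weights\<close>

lemma even_factor_refl: "even_factor s a a = 1"
proof -
  have "of_nat (2 * i + 1) - of_nat (2 * a) \<noteq> (0::complex)" for i
    unfolding right_minus_eq of_nat_eq_iff by presburger
  then show ?thesis by (simp add: even_factor_def coeff_He_ge del: of_nat_add of_nat_mult)
qed

lemma odd_factor_refl: "odd_factor s b b = 1"
proof -
  have "of_nat (b + s) - of_nat i \<noteq> (0::complex)" if "i < s" for i
    unfolding right_minus_eq of_nat_eq_iff using that by simp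
  then show ?thesis by (simp add: odd_factor_def coeff_He_ge del: of_nat_add of_nat_mult)
qed

text \<open>The minus sign and the factor \<open>2 * e + 1\<close> in the Hermite recurrence cancel
  against the telescoping product over the fixed degrees. One factor linear in \<open>s\<close>
  survives, which accounts for one power of \<open>2 * k\<close>.\<close>

lemma even_factor_rec:
  assumes "e < a"
  shows "even_factor s a e
    = even_factor s a (Suc e) * (of_nat (Suc e) / of_nat (a - e)) * (2 * of_nat s - 2 * of_nat e - 1)"
proof -
  define h where "h e = coeff (He (2 * a)) (2 * e)" for e
  define N where "N e = (\<Prod>i<s. of_nat (2 * i + 1) - of_nat (2 * e) :: complex)" for e :: nat
  have ef: "even_factor s a e = h e * N e / N a" for e
    by (simp add: even_factor_def h_def N_def prod_dividef)
  \<comment> \<open>Raising \<open>e\<close> by one shifts the factors by one place, so only the two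
    end factors differ. The relation is cross-multiplied to allow induction on
    \<open>s\<close>.\<close>
  have "N e * (- 1 - 2 * of_nat e) = N (Suc e) * (2 * of_nat s - 1 - 2 * of_nat e)"
    unfolding N_def by (induction s) (auto simp: algebra_simps)
  then have N: "(2 * of_nat e + 1) * N e = - ((2 * of_nat s - 1 - 2 * of_nat e) * N (Suc e))"
    by (simp add: algebra_simps)
  have ae: "of_nat (a - e) = (of_nat a - of_nat e :: complex)" "of_nat (a - e) \<noteq> (0::complex)"
    using assms by (simp_all add: of_nat_diff)
  have "(of_nat (2 * a) - of_nat (2 * e)) * h e = - (of_nat (2 * e + 2) * of_nat (2 * e + 1) * h (Suc e))"
    unfolding h_def using coeff_He_rec[of "2 * a" "2 * e"] by simp
  then have "2 * (of_nat (a - e) * h e) = 2 * (- (of_nat (Suc e) * (2 * of_nat e + 1) * h (Suc e)))"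
    unfolding ae(1) by (simp add: algebra_simps)
  then have h: "of_nat (a - e) * h e = - (of_nat (Suc e) * (2 * of_nat e + 1) * h (Suc e))"
    by (simp only: mult_cancel_left) simp
  have "of_nat (a - e) * (h e * N e) = - (of_nat (Suc e) * h (Suc e)) * ((2 * of_nat e + 1) * N e)"
    using arg_cong[OF h, of "\<lambda>z. z * N e"] by (simp only: mult_ac mult_minus_left mult_minus_right)
  also have "\<dots> = of_nat (Suc e) * h (Suc e) * N (Suc e) * (2 * of_nat s - 2 * of_nat e - 1)"
    unfolding N by (simp add: algebra_simps)
  finally have "h e * N e = h (Suc e) * N (Suc e) * (of_nat (Suc e) / of_nat (a - e)) * (2 * of_nat s - 2 * of_nat e - 1)"
    using ae(2) by (simp add: field_simps del: of_nat_Suc)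
  then show ?thesis unfolding ef by simp
qed

text \<open>Here the product over the fixed degrees is positive and does not cancel the minus sign
  of the Hermite recurrence. This sign is the source of \<open>x - 1\<close> for \<open>nu\<close>
  as opposed to \<open>x + 1\<close> for \<open>mu\<close>.\<close>

lemma odd_factor_rec:
  assumes "e < b"
  shows "odd_factor s b e
    = odd_factor s b (Suc e) * (of_nat (Suc e) / of_nat (b - e)) * (- (2 * of_nat s + 2 * of_nat e + 3))"
proof -
  define h where "h e = coeff (He (2 * (b + s) + 1)) (2 * (e + s) + 1)" for e
  define N where "N e = (\<Prod>i<s. of_nat (e + s) - of_nat i :: complex)" for e :: nat
  have ef: "odd_factor s b e = h e * N e / N b" for e
    by (simp add: odd_factor_def h_def N_def prod_dividef)
  \<comment> \<open>Reversing the order of the factors shows the rising product from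
    \<open>e + 1\<close> to \<open>e + s\<close>, whose neighbours differ only in the end
    factors.\<close>
  have N_alt: "N e = (\<Prod>i<s. of_nat (Suc (e + i)))" for e
    unfolding N_def
    by (rule prod.reindex_bij_witness[of _ "\<lambda>i. s - Suc i" "\<lambda>i. s - Suc i"])
       (auto simp: of_nat_diff)
  have N: "of_nat (e + s + 1) * N e = of_nat (Suc e) * N (Suc e)"
    unfolding N_alt by (induction s) (simp_all add: algebra_simps)
  have be: "of_nat (b - e) = (of_nat b - of_nat e :: complex)" "of_nat (b - e) \<noteq> (0::complex)"
    using assms by (simp_all add: of_nat_diff)
  have "(of_nat (2 * (b + s) + 1) - of_nat (2 * (e + s) + 1)) * h e
      = - (of_nat (2 * (e + s) + 3) * of_nat (2 * (e + s) + 2) * h (Suc e))"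
    unfolding h_def using coeff_He_rec[of "2 * (b + s) + 1" "2 * (e + s) + 1"] by (simp add: numeral_3_eq_3)
  then have "2 * (of_nat (b - e) * h e) = 2 * (- ((2 * of_nat s + 2 * of_nat e + 3) * of_nat (e + s + 1) * h (Suc e)))"
    unfolding be(1) by (simp add: algebra_simps)
  then have h: "of_nat (b - e) * h e = - ((2 * of_nat s + 2 * of_nat e + 3) * of_nat (e + s + 1) * h (Suc e))"
    by (simp only: mult_cancel_left) simp
  have "of_nat (b - e) * (h e * N e) = - ((2 * of_nat s + 2 * of_nat e + 3) * h (Suc e)) * (of_nat (e + s + 1) * N e)"
    using arg_cong[OF h, of "\<lambda>z. z * N e"] by (simp only: mult_ac mult_minus_left mult_minus_right)
  also have "\<dots> = of_nat (Suc e) * h (Suc e) * N (Suc e) * (- (2 * of_nat s + 2 * of_nat e + 3))"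
    unfolding N by (simp add: algebra_simps)
  finally have "h e * N e = h (Suc e) * N (Suc e) * (of_nat (Suc e) / of_nat (b - e)) * (- (2 * of_nat s + 2 * of_nat e + 3))"
    using be(2) by (simp add: field_simps del: of_nat_Suc)
  then show ?thesis unfolding ef by simp
qed

section \<open>Convergence with error of order \<open>1 / k\<close>\<close>

definition rate_limit :: "(nat \<Rightarrow> complex) \<Rightarrow> complex \<Rightarrow> bool" where
  "rate_limit f L \<longleftrightarrow> (\<lambda>k. f k - L) \<in> O(\<lambda>k. 1 / of_nat k)"

lemma inverse_nat_bigo_1: "(\<lambda>k. 1 / of_nat k :: complex) \<in> O(\<lambda>_. 1)"
  by (rule bigoI[of _ 1]) (auto simp: norm_divide divide_simps intro!: eventually_sequentiallyI[of 1])

lemma cmult_bigo: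
  fixes g h :: "nat \<Rightarrow> complex"
  shows "g \<in> O(h) \<Longrightarrow> (\<lambda>k. c * g k) \<in> O(h)"
  by (cases "c = 0") auto

lemma rate_limit_const: "rate_limit (\<lambda>_. c) c"
  by (simp add: rate_limit_def)

text \<open>Write \<open>f g - L M\<close> as
  \<open>(f - L) (g - M) + L (g - M) + M (f - L)\<close>; in the first term it suffices that one
  error is bounded.\<close>

lemma rate_limit_mult:
  assumes "rate_limit f L" "rate_limit g M"
  shows "rate_limit (\<lambda>k. f k * g k) (L * M)"
proof -
  have f: "(\<lambda>k. f k - L) \<in> O(\<lambda>k. 1 / of_nat k)" and g: "(\<lambda>k. g k - M) \<in> O(\<lambda>k. 1 / of_nat k)"
    using assms by (simp_all add: rate_limit_def)
  have "(\<lambda>k. f k - L) \<in> O(\<lambda>_. 1)" by (rule landau_o.big_trans[OF f inverse_nat_bigo_1])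
  from landau_o.big.mult[OF this g]
  have "(\<lambda>k. (f k - L) * (g k - M)) \<in> O(\<lambda>k. 1 / of_nat k)" by simp
  moreover have "(\<lambda>k. L * (g k - M)) \<in> O(\<lambda>k. 1 / of_nat k)" by (rule cmult_bigo[OF g])
  moreover have "(\<lambda>k. M * (f k - L)) \<in> O(\<lambda>k. 1 / of_nat k)" by (rule cmult_bigo[OF f])
  ultimately have "(\<lambda>k. (f k - L) * (g k - M) + L * (g k - M) + M * (f k - L)) \<in> O(\<lambda>k. 1 / of_nat k)"
    by (intro sum_in_bigo)
  then show ?thesis by (simp add: rate_limit_def algebra_simps)
qed

lemma rate_limit_prod:
  "(\<And>a. a \<in> A \<Longrightarrow> rate_limit (f a) (L a)) \<Longrightarrow> rate_limit (\<lambda>k. \<Prod>a\<in>A. f a k) (\<Prod>a\<in>A. L a)"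
  by (induction A rule: infinite_finite_induct) (auto intro: rate_limit_const rate_limit_mult)

lemma rate_limit_cong:
  assumes "eventually (\<lambda>k. f k = g k) sequentially" "rate_limit g L"
  shows "rate_limit f L"
proof -
  have "eventually (\<lambda>k. f k - L = g k - L) sequentially"
    using assms(1) by eventually_elim simp
  from landau_o.big.in_cong[OF this] show ?thesis using assms(2) by (simp add: rate_limit_def)
qed

lemma rate_limit_affine_div: "rate_limit (\<lambda>k. (of_nat k * c + d) / of_nat k) c"
proof -
  have "(\<lambda>k. d * (1 / of_nat k) :: complex) \<in> O(\<lambda>k. 1 / of_nat k)"
    by (rule cmult_bigo) simp
  then have "rate_limit (\<lambda>k. c + d / of_nat k) c" by (simp add: rate_limit_def)
  then show ?thesis
    by (rule rate_limit_cong[rotated])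
       (auto simp: field_simps intro!: eventually_sequentiallyI[of 1])
qed

lemma scaled_step: "X * Y * (2 * Z) / (P * (2 * c)) = X / P * Y * (Z / c)" for X Y Z P c :: complex
  by simp

context
  fixes p q :: nat and s :: "nat \<Rightarrow> nat"
  assumes s: "\<And>k. q \<le> k \<Longrightarrow> k + p = s k + q"
begin

lemma of_nat_s: "q \<le> k \<Longrightarrow> of_nat (s k) = (of_nat k + (of_nat p - of_nat q) :: complex)"
  using arg_cong[OF s, of k "of_nat :: nat \<Rightarrow> complex"] by (simp add: algebra_simps)

text \<open>Descending from \<open>e = a\<close>, each step contributes
  \<open>(e + 1) / (a - e)\<close> times a linear factor that tends to 1 after division by
  \<open>2 * k\<close>. Binomial absorption identifies the accumulated limit.\<close>

lemma rate_limit_even_factor: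
  assumes "e \<le> a"
  shows "rate_limit (\<lambda>k. even_factor (s k) a e / (2 * of_nat k) ^ (a - e)) (of_nat (a choose e))"
  using assms
proof (induction rule: inc_induct)
  case base
  show ?case by (simp add: even_factor_refl rate_limit_const)
next
  case (step e)
  \<comment> \<open>The constant term of \<open>2 * s k - 2 * e - 1\<close> once \<open>s k\<close>
    is written as \<open>k + p - q\<close>.\<close>
  let ?d = "2 * (of_nat p - of_nat q) - 2 * of_nat e - 1 :: complex"
  have lim: "of_nat (a choose Suc e) * (of_nat (Suc e) / of_nat (a - e)) * (1 :: complex) = of_nat (a choose e)"
  proof -
    have "(a choose Suc e) * Suc e = (a choose e) * (a - e)"
      by (metis binomial_absorb_comp binomial_absorption mult.commute)
    then have "of_nat (a choose Suc e) * of_nat (Suc e) = (of_nat (a choose e) * of_nat (a - e) :: complex)"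
      by (metis of_nat_mult)
    then show ?thesis using step by (simp add: field_simps del: of_nat_Suc)
  qed
  have "rate_limit (\<lambda>k. even_factor (s k) a (Suc e) / (2 * of_nat k) ^ (a - Suc e) * (of_nat (Suc e) / of_nat (a - e))
          * ((of_nat k * 1 + ?d / 2) / of_nat k)) (of_nat (a choose e))"
    unfolding lim[symmetric]
    by (intro rate_limit_mult step.IH rate_limit_const rate_limit_affine_div)
  moreover have "eventually (\<lambda>k. even_factor (s k) a e / (2 * of_nat k) ^ (a - e)
      = even_factor (s k) a (Suc e) / (2 * of_nat k) ^ (a - Suc e) * (of_nat (Suc e) / of_nat (a - e))
          * ((of_nat k * 1 + ?d / 2) / of_nat k)) sequentially"
  proof (rule eventually_sequentiallyI[of "Suc q"])
    fix k assume k: "Suc q \<le> k"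
    have pow: "(2 * of_nat k) ^ (a - e) = (2 * of_nat k) ^ (a - Suc e) * (2 * of_nat k :: complex)"
      using step by (metis Suc_diff_Suc power_Suc2)
    have linear: "2 * of_nat (s k) - 2 * of_nat e - 1 = 2 * (of_nat k * 1 + ?d / 2)"
      using k by (simp add: of_nat_s field_simps)
    show "even_factor (s k) a e / (2 * of_nat k) ^ (a - e)
      = even_factor (s k) a (Suc e) / (2 * of_nat k) ^ (a - Suc e) * (of_nat (Suc e) / of_nat (a - e))
          * ((of_nat k * 1 + ?d / 2) / of_nat k)"
      unfolding even_factor_rec[OF step(2)] pow linear by (rule scaled_step)
  qed
  ultimately show ?case by (rule rate_limit_cong[rotated])
qed

text \<open>The same descent, except that the scaled linear factor tends to -1 at each step.\<close>

lemma rate_limit_odd_factor: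
  assumes "e \<le> b"
  shows "rate_limit (\<lambda>k. odd_factor (s k) b e / (2 * of_nat k) ^ (b - e)) (of_nat (b choose e) * (- 1) ^ (b - e))"
  using assms
proof (induction rule: inc_induct)
  case base
  show ?case by (simp add: odd_factor_refl rate_limit_const)
next
  case (step e)
  let ?d = "- (2 * (of_nat p - of_nat q) + 2 * of_nat e + 3) :: complex"
  have lim: "of_nat (b choose Suc e) * (- 1) ^ (b - Suc e) * (of_nat (Suc e) / of_nat (b - e)) * (- 1 :: complex)
      = of_nat (b choose e) * (- 1) ^ (b - e)"
  proof -
    have "(b choose Suc e) * Suc e = (b choose e) * (b - e)"
      by (metis binomial_absorb_comp binomial_absorption mult.commute)
    then have "of_nat (b choose Suc e) * of_nat (Suc e) = (of_nat (b choose e) * of_nat (b - e) :: complex)"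
      by (metis of_nat_mult)
    then have "of_nat (b choose Suc e) * (of_nat (Suc e) / of_nat (b - e)) = (of_nat (b choose e) :: complex)"
      using step by (simp add: field_simps del: of_nat_Suc)
    moreover have "(- 1) ^ (b - e) = (- 1) ^ (b - Suc e) * (- 1 :: complex)"
      using step by (metis Suc_diff_Suc power_Suc2)
    moreover have "of_nat (b choose Suc e) * (- 1) ^ (b - Suc e) * (of_nat (Suc e) / of_nat (b - e)) * (- 1 :: complex)
        = of_nat (b choose Suc e) * (of_nat (Suc e) / of_nat (b - e)) * ((- 1) ^ (b - Suc e) * (- 1))"
      by (simp only: mult_ac)
    ultimately show ?thesis by simp
  qed
  have "rate_limit (\<lambda>k. odd_factor (s k) b (Suc e) / (2 * of_nat k) ^ (b - Suc e) * (of_nat (Suc e) / of_nat (b - e))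
          * ((of_nat k * (- 1) + ?d / 2) / of_nat k)) (of_nat (b choose e) * (- 1) ^ (b - e))"
    unfolding lim[symmetric]
    by (intro rate_limit_mult step.IH rate_limit_const rate_limit_affine_div)
  moreover have "eventually (\<lambda>k. odd_factor (s k) b e / (2 * of_nat k) ^ (b - e)
      = odd_factor (s k) b (Suc e) / (2 * of_nat k) ^ (b - Suc e) * (of_nat (Suc e) / of_nat (b - e))
          * ((of_nat k * (- 1) + ?d / 2) / of_nat k)) sequentially"
  proof (rule eventually_sequentiallyI[of "Suc q"])
    fix k assume k: "Suc q \<le> k"
    have pow: "(2 * of_nat k) ^ (b - e) = (2 * of_nat k) ^ (b - Suc e) * (2 * of_nat k :: complex)"
      using step by (metis Suc_diff_Suc power_Suc2)
    have linear: "- (2 * of_nat (s k) + 2 * of_nat e + 3) = 2 * (of_nat k * (- 1) + ?d / 2)"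
      using k by (simp add: of_nat_s field_simps)
    show "odd_factor (s k) b e / (2 * of_nat k) ^ (b - e)
      = odd_factor (s k) b (Suc e) / (2 * of_nat k) ^ (b - Suc e) * (of_nat (Suc e) / of_nat (b - e))
          * ((of_nat k * (- 1) + ?d / 2) / of_nat k)"
      unfolding odd_factor_rec[OF step(2)] pow linear by (rule scaled_step)
  qed
  ultimately show ?case by (rule rate_limit_cong[rotated])
qed

text \<open>Numerator and denominator differ by a constant, while the denominator grows at least
  like \<open>k\<close>.\<close>

lemma rate_limit_cross_factor: "rate_limit (\<lambda>k. cross_factor (s k) a b e e') 1"
proof -
  let ?D = "\<lambda>k. of_nat (2 * (b + s k) + 1) - of_nat (2 * a) :: complex"
  let ?c = "2 * of_nat e' - 2 * of_nat e - 2 * of_nat b + 2 * of_nat a :: complex"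
  \<comment> \<open>From this threshold on, \<open>s k = k + p - q\<close> is large enough for the
    even degree \<open>2 * a\<close> to be outweighed and the difference to be at least
    \<open>k\<close>.\<close>
  have large: "of_nat k \<le> norm (?D k)" "?D k \<noteq> 0" if "2 * (q + a) + 1 \<le> k" for k
  proof -
    have "s k + q = k + p" using s[of k] that by simp
    then have "2 * a + k \<le> 2 * (b + s k) + 1" using that by simp
    then obtain m where m: "2 * (b + s k) + 1 = 2 * a + k + m" by (metis le_Suc_ex)
    have "?D k = of_nat (k + m)" unfolding m by simp
    then have "norm (?D k) = real (k + m)" by (metis norm_of_nat)
    then show "of_nat k \<le> norm (?D k)" by simp
    then show "?D k \<noteq> 0" using that by auto
  qed
  have "(\<lambda>k. ?c / ?D k) \<in> O(\<lambda>k. 1 / of_nat k)"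
  proof (rule bigoI)
    show "eventually (\<lambda>k. norm (?c / ?D k) \<le> norm ?c * norm (1 / of_nat k :: complex)) sequentially"
    proof (rule eventually_sequentiallyI[of "2 * (q + a) + 1"])
      fix k assume k: "2 * (q + a) + 1 \<le> k"
      then show "norm (?c / ?D k) \<le> norm ?c * norm (1 / of_nat k :: complex)"
        using large[OF k] by (simp add: norm_divide divide_left_mono del: of_nat_add of_nat_mult of_nat_Suc)
    qed
  qed
  then have "rate_limit (\<lambda>k. 1 + ?c / ?D k) 1" by (simp add: rate_limit_def)
  then show ?thesis
  proof (rule rate_limit_cong[rotated], intro eventually_sequentiallyI[of "2 * (q + a) + 1"])
    fix k assume "2 * (q + a) + 1 \<le> k"
    then have nz: "?D k \<noteq> 0" by (rule large)
    have "cross_factor (s k) a b e e' = (?D k + ?c) / ?D k"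
      unfolding cross_factor_def by simp
    then show "cross_factor (s k) a b e e' = 1 + ?c / ?D k"
      using nz by (metis add_divide_distrib divide_self)
  qed
qed

end

section \<open>Assembling the rescaled sum and its limit\<close>

definition scaled_term ::
    "nat set \<Rightarrow> nat set \<Rightarrow> (nat \<Rightarrow> nat) \<Rightarrow> (nat \<Rightarrow> nat) \<Rightarrow> nat \<Rightarrow> nat \<Rightarrow> complex" where
  "scaled_term A B \<alpha> \<beta> s k = pair_ratio A \<alpha> * pair_ratio B \<beta>
     * (\<Prod>a\<in>A. even_factor s a (\<alpha> a) / (2 * of_nat k) ^ (a - \<alpha> a))
     * (\<Prod>b\<in>B. odd_factor s b (\<beta> b) / (2 * of_nat k) ^ (b - \<beta> b))
     * (\<Prod>a\<in>A. \<Prod>b\<in>B. cross_factor s a b (\<alpha> a) (\<beta> b))"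

lemma rate_limit_scaled_term:
  assumes s: "\<And>k. q \<le> k \<Longrightarrow> k + p = s k + q"
    and "\<alpha> \<in> PiE A (\<lambda>a. {..a})" "\<beta> \<in> PiE B (\<lambda>b. {..b})"
  shows "rate_limit (\<lambda>k. scaled_term A B \<alpha> \<beta> (s k) k)
     (pair_ratio A \<alpha> * pair_ratio B \<beta> * (\<Prod>a\<in>A. of_nat (a choose \<alpha> a))
       * (\<Prod>b\<in>B. of_nat (b choose \<beta> b) * (- 1) ^ (b - \<beta> b)))"
proof -
  have "rate_limit (\<lambda>k. scaled_term A B \<alpha> \<beta> (s k) k)
     (pair_ratio A \<alpha> * pair_ratio B \<beta> * (\<Prod>a\<in>A. of_nat (a choose \<alpha> a))
       * (\<Prod>b\<in>B. of_nat (b choose \<beta> b) * (- 1) ^ (b - \<beta> b)) * (\<Prod>a\<in>A. \<Prod>b\<in>B. 1))"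
    unfolding scaled_term_def using assms(2,3)
    by (intro rate_limit_mult rate_limit_prod rate_limit_const rate_limit_even_factor[OF s]
        rate_limit_odd_factor[OF s] rate_limit_cross_factor[OF s]) (auto simp: PiE_def)
  then show ?thesis by simp
qed

lemma sum_diff_PiE:
  fixes A :: "nat set"
  assumes "\<alpha> \<in> PiE A (\<lambda>a. {..a})"
  shows "(\<Sum>a\<in>A. a - \<alpha> a) + sum \<alpha> A = \<Sum>A"
  unfolding sum.distrib[symmetric] by (rule sum.cong) (use PiE_mem[OF assms] in auto)

text \<open>For injective choices, \<open>M + N\<close> is the total lowering of exponents plus the
  remaining exponent of \<open>x\<close>. The first share of \<open>2 * k\<close> is distributed
  over the factors; the second cancels against the rescaled argument. For other choices both sides
  vanish.\<close>

lemma scaled_weight_term: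
  assumes fin: "finite A" "finite B" and AB: "\<alpha> \<in> PiE A (\<lambda>a. {..a})" "\<beta> \<in> PiE B (\<lambda>b. {..b})"
    and sums: "\<Sum>A = M + tri_below (card A)" "\<Sum>B = N + tri_below (card B)" and k: "1 \<le> k"
  shows "weight (merge_degs A B s) (merge_map A B s \<alpha> \<beta>)
           * (2 * of_nat k * x) ^ ((sum \<alpha> A - tri_below (card A)) + (sum \<beta> B - tri_below (card B)))
           / (2 * of_nat k) ^ (M + N)
         = scaled_term A B \<alpha> \<beta> s k * (x ^ (sum \<alpha> A - tri_below (card A)) * x ^ (sum \<beta> B - tri_below (card B)))"
proof (cases "inj_on \<alpha> A \<and> inj_on \<beta> B")
  case False
  then have "pair_ratio A \<alpha> * pair_ratio B \<beta> = 0" using pair_ratio_eq_0 fin by fastforce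
  then show ?thesis by (auto simp: weight_merge_map[OF fin] scaled_term_def)
next
  case True
  let ?u = "sum \<alpha> A - tri_below (card A)" and ?v = "sum \<beta> B - tri_below (card B)"
  define c :: complex where "c = 2 * of_nat k"
  have c: "c \<noteq> 0" using k by (simp add: c_def)
  have A: "(\<Sum>a\<in>A. a - \<alpha> a) + ?u = M"
    using sum_diff_PiE[OF AB(1)] sums(1) tri_below_le_sum_inj[OF fin(1)] True by fastforce
  have B: "(\<Sum>b\<in>B. b - \<beta> b) + ?v = N"
    using sum_diff_PiE[OF AB(2)] sums(2) tri_below_le_sum_inj[OF fin(2)] True by fastforce
  have denom: "c ^ (M + N) = (\<Prod>a\<in>A. c ^ (a - \<alpha> a)) * (\<Prod>b\<in>B. c ^ (b - \<beta> b)) * c ^ (?u + ?v)"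
    unfolding A[symmetric] B[symmetric] by (simp only: power_sum power_add mult_ac)
  have numer: "(c * x) ^ (?u + ?v) = c ^ (?u + ?v) * (x ^ ?u * x ^ ?v)"
    by (simp add: power_mult_distrib power_add)
  have cancel: "W * (z * y) / (d * z) = W / d * y" if "z \<noteq> 0" for W z y d :: complex
    using that by simp
  show ?thesis
    unfolding c_def[symmetric] denom numer cancel[OF power_not_zero[OF c]] weight_merge_map[OF fin]
      scaled_term_def prod_dividef by (simp add: mult_ac)
qed

lemma scaled_R_Phi:
  assumes mu: "is_partition mu" and nu: "is_partition nu" and k: "k + length mu = s + length nu" "1 \<le> k"
  defines "A \<equiv> set (degs mu)" and "B \<equiv> set (degs nu)"
  shows "poly (R_Phi mu nu k) (2 * of_nat k * x) / (2 * of_nat k) ^ (sum_list mu + sum_list nu)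
    = (\<Sum>(\<alpha>, \<beta>)\<in>PiE A (\<lambda>a. {..a}) \<times> PiE B (\<lambda>b. {..b}). scaled_term A B \<alpha> \<beta> s k
        * (x ^ (sum \<alpha> A - tri_below (length mu)) * x ^ (sum \<beta> B - tri_below (length nu))))"
proof -
  have sorted: "sorted_wrt (\<ge>) mu" "sorted_wrt (\<ge>) nu" using mu nu by (simp_all add: is_partition_def)
  have card: "card A = length mu" "card B = length nu"
    using sorted sorted_degs sorted_wrt_greater_imp_distinct by (auto simp: A_def B_def distinct_card)
  have "poly (R_Phi mu nu k) (2 * of_nat k * x) / (2 * of_nat k) ^ (sum_list mu + sum_list nu)
    = (\<Sum>(\<alpha>, \<beta>)\<in>PiE A (\<lambda>a. {..a}) \<times> PiE B (\<lambda>b. {..b}).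
        weight (merge_degs A B s) (merge_map A B s \<alpha> \<beta>)
        * (2 * of_nat k * x) ^ ((sum \<alpha> A - tri_below (card A)) + (sum \<beta> B - tri_below (card B)))
        / (2 * of_nat k) ^ (sum_list mu + sum_list nu))"
    unfolding R_Phi_expansion[OF mu nu k(1)] A_def[symmetric] B_def[symmetric] card
    by (simp add: poly_sum poly_monom sum_divide_distrib case_prod_unfold)
  also have "\<dots> = (\<Sum>(\<alpha>, \<beta>)\<in>PiE A (\<lambda>a. {..a}) \<times> PiE B (\<lambda>b. {..b}). scaled_term A B \<alpha> \<beta> s k
        * (x ^ (sum \<alpha> A - tri_below (card A)) * x ^ (sum \<beta> B - tri_below (card B))))"
  proof (intro sum.cong[OF refl], clarify)
    fix \<alpha> \<beta> assume "\<alpha> \<in> PiE A (\<lambda>a. {..a})" "\<beta> \<in> PiE B (\<lambda>b. {..b})"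
    then show "weight (merge_degs A B s) (merge_map A B s \<alpha> \<beta>)
        * (2 * of_nat k * x) ^ ((sum \<alpha> A - tri_below (card A)) + (sum \<beta> B - tri_below (card B)))
        / (2 * of_nat k) ^ (sum_list mu + sum_list nu)
        = scaled_term A B \<alpha> \<beta> s k * (x ^ (sum \<alpha> A - tri_below (card A)) * x ^ (sum \<beta> B - tri_below (card B)))"
      using sorted k(2) by (intro scaled_weight_term) (simp_all add: card sum_degs A_def B_def flip: card)
  qed
  finally show ?thesis unfolding card .
qed

text \<open>Multiplying the binomial expansions for \<open>c = 1\<close> and \<open>c = - 1\<close>
  gives a sum over the same index set and powers of \<open>x\<close> as the rescaled polynomial, so
  the two can be compared term by term.\<close>

lemma limit_expansion:
  fixes x :: complex
  assumes mu: "sorted_wrt (\<ge>) mu" and nu: "sorted_wrt (\<ge>) nu"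
  defines "A \<equiv> set (degs mu)" and "B \<equiv> set (degs nu)"
  shows "(x + 1) ^ sum_list mu * (x - 1) ^ sum_list nu
    = (\<Sum>(\<alpha>, \<beta>)\<in>PiE A (\<lambda>a. {..a}) \<times> PiE B (\<lambda>b. {..b}).
        pair_ratio A \<alpha> * pair_ratio B \<beta> * (\<Prod>a\<in>A. of_nat (a choose \<alpha> a))
          * (\<Prod>b\<in>B. of_nat (b choose \<beta> b) * (- 1) ^ (b - \<beta> b))
        * (x ^ (sum \<alpha> A - tri_below (length mu)) * x ^ (sum \<beta> B - tri_below (length nu))))"
proof -
  have "(x + 1) ^ sum_list mu * (x - 1) ^ sum_list nu
      = (\<Sum>\<alpha>\<in>PiE A (\<lambda>a. {..a}). pair_ratio A \<alpha> * (\<Prod>a\<in>A. of_nat (a choose \<alpha> a)) * x ^ (sum \<alpha> A - tri_below (length mu)))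
        * (\<Sum>\<beta>\<in>PiE B (\<lambda>b. {..b}). pair_ratio B \<beta> * (\<Prod>b\<in>B. of_nat (b choose \<beta> b) * (- 1) ^ (b - \<beta> b))
            * x ^ (sum \<beta> B - tri_below (length nu)))"
    using sum_pair_ratio_binomial[OF mu, of 1 x] sum_pair_ratio_binomial[OF nu, of "- 1" x]
    by (simp add: A_def B_def)
  then show ?thesis
    unfolding sum_product sum.cartesian_product by (simp add: case_prod_unfold mult_ac)
qed

theorem theorem5p1:
  fixes mu nu :: "nat list" and K :: "complex set"
  assumes "is_partition mu" and "is_partition nu" and "compact K"
  shows "uniform_limit K
           (\<lambda>k x. poly (R_Phi mu nu k) (2 * of_nat k * x) / (2 * of_nat k) ^ (sum_list mu + sum_list nu))
           (\<lambda>x. (x + 1) ^ sum_list mu * (x - 1) ^ sum_list nu) sequentially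
       \<and> (\<exists>C. \<forall>k\<ge>1. \<forall>x\<in>K.
             norm (poly (R_Phi mu nu k) (2 * of_nat k * x) / (2 * of_nat k) ^ (sum_list mu + sum_list nu)
                   - (x + 1) ^ sum_list mu * (x - 1) ^ sum_list nu) \<le> C / real k)"
proof -
  define F where "F k x = poly (R_Phi mu nu k) (2 * of_nat k * x) / (2 * of_nat k) ^ (sum_list mu + sum_list nu)"
    for k x
  define G :: "complex \<Rightarrow> complex" where "G x = (x + 1) ^ sum_list mu * (x - 1) ^ sum_list nu" for x
  define A where "A = set (degs mu)"
  define B where "B = set (degs nu)"
  define P where "P = PiE A (\<lambda>a. {..a}) \<times> PiE B (\<lambda>b. {..b})"
  \<comment> \<open>The natural subtraction is exact once \<open>k\<close> reaches
    \<open>length nu\<close>; smaller \<open>k\<close> are treated by compactness alone.\<close>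
  define s where "s k = k + length mu - length nu" for k
  define u where "u = (\<lambda>(\<alpha>, \<beta>). (sum \<alpha> A - tri_below (length mu)) + (sum \<beta> B - tri_below (length nu)))"
  define T where "T k = (\<lambda>(\<alpha>, \<beta>). scaled_term A B \<alpha> \<beta> (s k) k)" for k
  define L :: "(nat \<Rightarrow> nat) \<times> (nat \<Rightarrow> nat) \<Rightarrow> complex" where
    "L = (\<lambda>(\<alpha>, \<beta>). pair_ratio A \<alpha> * pair_ratio B \<beta> * (\<Prod>a\<in>A. of_nat (a choose \<alpha> a))
       * (\<Prod>b\<in>B. of_nat (b choose \<beta> b) * (- 1) ^ (b - \<beta> b)))"
  have s: "k + length mu = s k + length nu" if "length nu \<le> k" for k
    using that by (simp add: s_def)
  have sorted: "sorted_wrt (\<ge>) mu" "sorted_wrt (\<ge>) nu" using assms by (simp_all add: is_partition_def)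
  obtain b where b: "1 \<le> b" "\<And>x. x \<in> K \<Longrightarrow> norm x \<le> b"
    using compact_imp_bounded[OF assms(3)] unfolding bounded_iff by (metis max.cobounded1 max.coboundedI2)
  have F: "F k x = (\<Sum>t\<in>P. T k t * x ^ u t)" if "length nu \<le> k" "1 \<le> k" for k x
    unfolding F_def scaled_R_Phi[OF assms(1,2) s[OF that(1)] that(2)]
    by (simp add: P_def A_def B_def T_def u_def power_add case_prod_unfold)
  have G: "G x = (\<Sum>t\<in>P. L t * x ^ u t)" for x
    unfolding G_def limit_expansion[OF sorted]
    by (simp add: P_def A_def B_def L_def u_def power_add case_prod_unfold)
  have rate: "(\<lambda>k. T k t - L t) \<in> O(\<lambda>k. 1 / of_nat k)" if "t \<in> P" for t
    using rate_limit_scaled_term[of "length nu" "length mu" s "fst t" A "snd t" B] s that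
    by (auto simp: rate_limit_def T_def L_def P_def)
  \<comment> \<open>\<open>P\<close> does not depend on \<open>k\<close>, and bounding
    \<open>norm x\<close> by \<open>b\<close> makes the error estimate uniform on
    \<open>K\<close>.\<close>
  have "(\<lambda>k. \<Sum>t\<in>P. norm (T k t - L t) * b ^ u t) \<in> O(\<lambda>k. 1 / real k)"
  proof (rule big_sum_in_bigo)
    fix t assume "t \<in> P"
    then obtain c where "eventually (\<lambda>k. norm (T k t - L t) \<le> c * norm (1 / of_nat k :: complex)) sequentially"
      using landau_o.bigE[OF rate] by blast
    then show "(\<lambda>k. norm (T k t - L t) * b ^ u t) \<in> O(\<lambda>k. 1 / real k)"
    proof (intro bigoI[of _ "c * b ^ u t"], elim eventually_mono)
      fix k assume "norm (T k t - L t) \<le> c * norm (1 / of_nat k :: complex)"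
      then have "norm (T k t - L t) * b ^ u t \<le> c * norm (1 / of_nat k :: complex) * b ^ u t"
        using b(1) by (intro mult_right_mono) auto
      then show "norm (norm (T k t - L t) * b ^ u t) \<le> c * b ^ u t * norm (1 / real k)"
        using b(1) by (simp add: norm_divide abs_mult mult_ac)
    qed
  qed
  then obtain c where "eventually (\<lambda>k. norm (\<Sum>t\<in>P. norm (T k t - L t) * b ^ u t) \<le> c * norm (1 / real k)) sequentially"
    using landau_o.bigE by blast
  then obtain k0 where k0: "\<And>k. k0 \<le> k \<Longrightarrow> norm (\<Sum>t\<in>P. norm (T k t - L t) * b ^ u t) \<le> c * norm (1 / real k)"
    unfolding eventually_sequentially by blast
  have large: "norm (F k x - G x) \<le> c / real k" if "max k0 (max 1 (length nu)) \<le> k" "x \<in> K" for k x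
  proof -
    have k: "length nu \<le> k" "1 \<le> k" "k0 \<le> k" using that by auto
    have "norm (F k x - G x) = norm (\<Sum>t\<in>P. (T k t - L t) * x ^ u t)"
      unfolding F[OF k(1,2)] G by (simp add: left_diff_distrib sum_subtractf)
    also have "\<dots> \<le> (\<Sum>t\<in>P. norm (T k t - L t) * b ^ u t)"
      using b(2)[OF that(2)]
      by (intro sum_norm_le) (auto simp: norm_mult norm_power intro!: mult_left_mono power_mono)
    also have "\<dots> \<le> c / real k" using k0[OF k(3)] by simp
    finally show ?thesis .
  qed
  \<comment> \<open>The explicit bound is claimed from \<open>k = 1\<close> on. The finitely many
    \<open>k\<close> below the asymptotic range are bounded by continuity on the compact
    set.\<close>
  have "\<exists>M\<ge>0. \<forall>x\<in>K. norm (F k x - G x) \<le> M" for k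
  proof -
    have "continuous_on K (\<lambda>x. F k x - G x)"
      unfolding F_def G_def divide_inverse by (intro continuous_intros)
    then have "bounded ((\<lambda>x. F k x - G x) ` K)"
      using assms(3) by (intro compact_imp_bounded compact_continuous_image)
    then obtain M where "\<forall>x\<in>K. norm (F k x - G x) \<le> M" unfolding bounded_iff by auto
    then show ?thesis by (intro exI[of _ "max 0 M"]) (auto simp: le_max_iff_disj)
  qed
  then obtain M where M: "\<And>k. 0 \<le> M k" "\<And>k x. x \<in> K \<Longrightarrow> norm (F k x - G x) \<le> M k" by metis
  define n0 where "n0 = max k0 (max 1 (length nu))"
  \<comment> \<open>Each summand \<open>k * M k\<close> covers one small \<open>k\<close>, and
    \<open>\<bar>c\<bar>\<close> covers all large ones; since everything is non-negative, the sum
    dominates each part.\<close>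
  define C where "C = \<bar>c\<bar> + (\<Sum>k<n0. real k * M k)"
  have bound: "norm (F k x - G x) \<le> C / real k" if "1 \<le> k" "x \<in> K" for k x
  proof (cases "k < n0")
    case True
    have "norm (F k x - G x) \<le> real k * M k / real k" using M(2)[OF that(2)] that(1) by simp
    also have "real k * M k \<le> (\<Sum>k<n0. real k * M k)"
      using True M(1) by (intro member_le_sum) auto
    finally show ?thesis
      unfolding C_def by (rule order_trans) (auto intro: divide_right_mono)
  next
    case False
    then have "norm (F k x - G x) \<le> c / real k" using large[of k x] that(2) unfolding n0_def not_less by blast
    also have "\<dots> \<le> C / real k"
      unfolding C_def using M(1) by (intro divide_right_mono) (auto intro!: add_increasing2 sum_nonneg)
    finally show ?thesis .
  qed
  have "uniform_limit K F G sequentially"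
  proof (rule uniform_limitI)
    fix e :: real assume "0 < e"
    have "(\<lambda>k. C / real k) \<longlonglongrightarrow> 0" by (rule lim_const_over_n)
    then have "eventually (\<lambda>k. C / real k < e) sequentially"
      using \<open>0 < e\<close> by (rule order_tendstoD(2))
    then show "eventually (\<lambda>k. \<forall>x\<in>K. dist (F k x) (G x) < e) sequentially"
      using eventually_ge_at_top[of "1::nat"]
    proof eventually_elim
      case (elim k)
      then show ?case using bound[of k] by (force simp: dist_norm)
    qed
  qed
  then show ?thesis using bound unfolding F_def G_def by blast
qed

end
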